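(* Let $f\in\mathcal F$ and let $g(\lambda)=h(\lambda)\,t(\lambda)^{-\alpha}$, $\lambda\in\Lambda$, where $\alpha>0$, $h\in B_+^-$ and $t$ is a nonnegative trigonometric polynomial not identically zero. Then $g\in\mathcal M_f$ and $fg\in\mathcal F$ provided that either (a) $\alpha\in\mathbb Z$ and $f t^{-\alpha}\in L^1(\Lambda)$, or (b) $\alpha\notin\mathbb Z$ and $f t^{-(k+1)}\in L^1(\Lambda)$, where $k=\lfloor\alpha\rfloor$.
   Context: $\Lambda=[-\pi,\pi]$. $G(h)=\exp\{\frac1{2\pi}\int_\Lambda\ln h\,d\lambda\}$ if $\ln h\in L^1(\Lambda)$, else $0$. $\sigma_n^2(f)=\min_{c_1,\dots,c_n\in\mathbb C}\int_\Lambda|1-\sum_{k=1}^n c_ke^{-ik\lambda}|^2f(\lambda)\,d\lambda$, $\sigma_n(f)=\sqrt{\sigma_n^2(f)}$. $\mathcal F=\{f\in L^1(\Lambda): f\ge0,\ G(f)=0,\ \lim_{n}\sigma_{n+1}(f)/\sigma_n(f)=1\}$. For $f\in\mathcal F$, $\mathcal M_f=\{g\ge0: G(g)>0,\ fg\in L^1(\Lambda),\ \lim_{n}\sigma_n^2(fg)/\sigma_n^2(f)=G(g)\}$. $B$ = nonnegative Riemann integrable functions on $\Lambda$; $B_+^-=\{h\in B: m\le h\le M\text{ for some constants }0<m\le M\}$. Trigonometric polynomial: $t(\lambda)=\sum_{k=-\nu}^{\nu}c_ke^{ik\lambda}$. *)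

theory Defs
  imports "HOL-Analysis.Analysis"
begin

definition Lam :: "real set" where
  "Lam = {-pi..pi}"

definition L1 :: "(real \<Rightarrow> real) \<Rightarrow> bool" where
  "L1 h \<longleftrightarrow> integrable (lebesgue_on Lam) h"

definition Lint :: "(real \<Rightarrow> real) \<Rightarrow> real" where
  "Lint h = integral\<^sup>L (lebesgue_on Lam) h"

text \<open>Geometric mean G(h). Since ln 0 = 0 in Isabelle, the requirement
  "ln h in L^1" is rendered as: h > 0 a.e. on Lam and ln h integrable.\<close>

definition geom_mean :: "(real \<Rightarrow> real) \<Rightarrow> real" where
  "geom_mean h =
     (if (AE x in lebesgue_on Lam. h x > 0) \<and> L1 (\<lambda>x. ln (h x))
      then exp (Lint (\<lambda>x. ln (h x)) / (2 * pi)) else 0)"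

definition pred_err2 :: "nat \<Rightarrow> (real \<Rightarrow> real) \<Rightarrow> real" where
  "pred_err2 n f =
     Inf {Lint (\<lambda>x. (cmod (1 - (\<Sum>k=1..n. c k * exp (- \<i> * of_nat k * of_real x))))\<^sup>2 * f x)
          | c :: nat \<Rightarrow> complex. True}"

definition pred_err :: "nat \<Rightarrow> (real \<Rightarrow> real) \<Rightarrow> real" where
  "pred_err n f = sqrt (pred_err2 n f)"

definition classF :: "(real \<Rightarrow> real) \<Rightarrow> bool" where
  "classF f \<longleftrightarrow> L1 f \<and> (\<forall>x\<in>Lam. f x \<ge> 0) \<and> geom_mean f = 0 \<and>
     (\<lambda>n. pred_err (Suc n) f / pred_err n f) \<longlonglongrightarrow> 1"

definition classM :: "(real \<Rightarrow> real) \<Rightarrow> (real \<Rightarrow> real) \<Rightarrow> bool" where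
  "classM f g \<longleftrightarrow> (\<forall>x\<in>Lam. g x \<ge> 0) \<and> geom_mean g > 0 \<and> L1 (\<lambda>x. f x * g x) \<and>
     (\<lambda>n. pred_err2 n (\<lambda>x. f x * g x) / pred_err2 n f) \<longlonglongrightarrow> geom_mean g"

definition riemann_integrable_on :: "(real \<Rightarrow> real) \<Rightarrow> real \<Rightarrow> real \<Rightarrow> bool" where
  "riemann_integrable_on h a b \<longleftrightarrow>
     bounded (h ` {a..b}) \<and>
     (\<forall>\<epsilon>>0. \<exists>(p :: nat \<Rightarrow> real) m. p 0 = a \<and> p m = b \<and> (\<forall>i<m. p i < p (Suc i)) \<and>
        (\<Sum>i<m. (p (Suc i) - p i) * ((SUP x\<in>{p i..p (Suc i)}. h x) - (INF x\<in>{p i..p (Suc i)}. h x)))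
          < \<epsilon>)"

definition classB :: "(real \<Rightarrow> real) \<Rightarrow> bool" where
  "classB h \<longleftrightarrow> (\<forall>x\<in>Lam. h x \<ge> 0) \<and> riemann_integrable_on h (-pi) pi"

definition classBpm :: "(real \<Rightarrow> real) \<Rightarrow> bool" where
  "classBpm h \<longleftrightarrow> classB h \<and> (\<exists>m M. 0 < m \<and> m \<le> M \<and> (\<forall>x\<in>Lam. m \<le> h x \<and> h x \<le> M))"

definition trig_poly :: "(real \<Rightarrow> real) \<Rightarrow> bool" where
  "trig_poly t \<longleftrightarrow> (\<exists>(\<nu>::nat) (c :: int \<Rightarrow> complex). \<forall>x.
     complex_of_real (t x) = (\<Sum>k\<in>{-int \<nu>..int \<nu>}. c k * exp (\<i> * of_int k * of_real x)))"

end

theory Submission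
  imports Defs "HOL-Computational_Algebra.Fundamental_Theorem_Algebra"
begin

text \<open>
  The error \<open>\<sigma>\<^sub>n\<^sup>2(w)\<close> is the infimum of \<open>\<integral>|p|\<^sup>2 w\<close> over polynomials \<open>p\<close> in \<open>exp (ix)\<close> of degree at most
  \<open>n\<close> with \<open>p(0) = 1\<close>. If \<open>|q|\<^sup>2 w \<le> v\<close> for a polynomial \<open>q\<close> of degree \<open>\<nu>\<close>, multiplying
  competitors by \<open>q / q(0)\<close> gives \<open>|q(0)|\<^sup>2 \<sigma>\<^sub>n\<^sub>+\<^sub>\<nu>\<^sup>2(w) \<le> \<sigma>\<^sub>n\<^sup>2(v)\<close>, and for \<open>f\<close> in the class F
  the shift by \<open>\<nu>\<close> is harmless in the limit. Hence it suffices to find, for every \<open>\<delta> > 0\<close>,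
  polynomials \<open>s\<close> and \<open>r\<close> with \<open>|s|\<^sup>2 \<le> g\<close>, \<open>|s(0)|\<^sup>2 \<ge> exp (-\<delta>) G(g)\<close> and
  \<open>|r|\<^sup>2 g \<le> 1\<close>, \<open>|r(0)|\<^sup>2 \<ge> exp (-\<delta>) / G(g)\<close>.

  If \<open>u\<close> is bounded and almost everywhere continuous, then \<open>u\<close> can be approximated from below in mean
  by \<open>Re A\<close> on the circle with a polynomial \<open>A\<close>, and a Taylor polynomial of \<open>exp (A/2)\<close> has modulus
  squared at most \<open>exp u\<close> and value at 0 close to \<open>exp\<close> of half the mean of \<open>u\<close>. This gives \<open>s\<close>, applied to
  \<open>u = ln h - \<alpha> ln (t + \<epsilon>)\<close>. For \<open>r\<close> the poles of \<open>g\<close> are first removed: write \<open>t = |R|\<close> on the circle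
  with \<open>R\<close> free of zeros in the open disc, so that \<open>|R(0)| = G(t)\<close>, choose \<open>K\<close> with \<open>2K \<ge> \<alpha>\<close>, and take
  \<open>r = R\<^sup>K q\<close> with \<open>q\<close> obtained from \<open>u = - ln h - (2K - \<alpha>) ln (t + \<epsilon>)\<close>.
\<close>

section \<open>Almost everywhere continuity of Riemann integrable functions\<close>

lemma partition_locate:
  fixes p :: "nat \<Rightarrow> real"
  assumes "p 0 \<le> x" "x \<le> p m" "0 < m"
  shows "\<exists>i<m. p i \<le> x \<and> x \<le> p (Suc i)"
  using assms
proof (induction m)
  case 0
  then show ?case by simp
next
  case (Suc m)
  show ?case
  proof (cases "x \<le> p m \<and> 0 < m")
    case True
    then show ?thesis using Suc less_Suc_eq by blast
  next
    case False
    then show ?thesis using Suc.prems by (metis lessI linear neq0_conv)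
  qed
qed

text \<open>A Chebyshev estimate for oscillations. A point of the set is a partition point or lies
  inside a subinterval with oscillation at least \<open>c\<close>, and such subintervals have total
  length at most the Darboux gap divided by \<open>c\<close>. A gap below \<open>c * e\<close> thus
  yields a cover of measure below \<open>e\<close>.\<close>

lemma riemann_integrable_osc_negligible:
  fixes h :: "real \<Rightarrow> real"
  assumes h: "riemann_integrable_on h a b" and "a < b" and c: "0 < c"
  shows "negligible {x\<in>{a<..<b}. \<forall>\<delta>>0. \<exists>y. \<bar>y - x\<bar> < \<delta> \<and> c \<le> \<bar>h y - h x\<bar>}" (is "negligible ?D")
  unfolding negligible_outer
proof (intro allI impI)
  fix e :: real
  assume e: "0 < e"
  have bd: "bounded (h ` {a..b})"
    using h by (simp add: riemann_integrable_on_def)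
  have "0 < c * e" using c e by simp
  then obtain p :: "nat \<Rightarrow> real" and m where p0: "p 0 = a" and pm: "p m = b"
    and mono: "\<And>i. i < m \<Longrightarrow> p i < p (Suc i)"
    and sm: "(\<Sum>i<m. (p (Suc i) - p i) * ((SUP x\<in>{p i..p (Suc i)}. h x) - (INF x\<in>{p i..p (Suc i)}. h x))) < c * e"
    using h unfolding riemann_integrable_on_def by meson
  have "0 < m" using p0 pm \<open>a < b\<close> by (cases m) auto
  have le: "i \<le> j \<Longrightarrow> j \<le> m \<Longrightarrow> p i \<le> p j" for i j
  proof (induction j)
    case (Suc j)
    then show ?case using mono[of j] by (cases "i = Suc j") fastforce+
  qed simp
  have sub: "{p i..p (Suc i)} \<subseteq> {a..b}" if "i < m" for i
    using le[of 0 i] le[of "Suc i" m] that p0 pm by auto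
  define osc where "osc i = (SUP x\<in>{p i..p (Suc i)}. h x) - (INF x\<in>{p i..p (Suc i)}. h x)" for i
  have oscb: "\<bar>h y - h x\<bar> \<le> osc i" if "i < m" "x \<in> {p i..p (Suc i)}" "y \<in> {p i..p (Suc i)}" for i x y
  proof -
    have B: "bounded (h ` {p i..p (Suc i)})"
      using bd sub[OF that(1)] by (meson bounded_subset image_mono)
    then have "bdd_above (h ` {p i..p (Suc i)})" "bdd_below (h ` {p i..p (Suc i)})"
      by (auto simp: bounded_imp_bdd_above bounded_imp_bdd_below)
    then have "h z \<le> (SUP x\<in>{p i..p (Suc i)}. h x) \<and> (INF x\<in>{p i..p (Suc i)}. h x) \<le> h z"
      if "z \<in> {p i..p (Suc i)}" for z
      using that by (auto intro: cSUP_upper cINF_lower)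
    from this[OF that(2)] this[OF that(3)] show ?thesis unfolding osc_def by auto
  qed
  have osc0: "0 \<le> osc i" if "i < m" for i
    using oscb[OF that, of "p i" "p i"] mono[OF that] by auto
  define I where "I = {i. i < m \<and> c \<le> osc i}"
  have finI: "finite I" by (auto simp: I_def)
  define T where "T = p ` {..m} \<union> (\<Union>i\<in>I. {p i..p (Suc i)})"
  show "\<exists>T. ?D \<subseteq> T \<and> T \<in> lmeasurable \<and> measure lebesgue T < e"
  proof (intro exI conjI)
    show "?D \<subseteq> T"
    proof
      fix x assume x: "x \<in> ?D"
      then have "p 0 \<le> x" "x \<le> p m" using p0 pm by auto
      from partition_locate[OF this \<open>0 < m\<close>] obtain i
        where i: "i < m" "p i \<le> x" "x \<le> p (Suc i)" by blast
      show "x \<in> T"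
      proof (cases "x = p i \<or> x = p (Suc i)")
        case True
        then have "x \<in> p ` {..m}" using i(1) by auto
        then show ?thesis by (simp add: T_def)
      next
        case False
        \<comment> \<open>This radius keeps \<open>y\<close> in the subinterval of \<open>x\<close>,
          so that the variation counts towards its oscillation.\<close>
        then have "0 < min (x - p i) (p (Suc i) - x)" using i by auto
        then obtain y where y: "\<bar>y - x\<bar> < min (x - p i) (p (Suc i) - x)" "c \<le> \<bar>h y - h x\<bar>"
          using x by blast
        then have "\<bar>h y - h x\<bar> \<le> osc i" using i by (intro oscb) auto
        then have "i \<in> I" using y i by (auto simp: I_def)
        then show ?thesis using i by (auto simp: T_def)
      qed
    qed
    show lm: "T \<in> lmeasurable"
      unfolding T_def using finI
      by (intro fmeasurable.Un fmeasurable.finite_UN) (auto simp: lmeasurable_interval negligible_imp_measurable negligible_finite)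
    have "measure lebesgue T \<le> measure lebesgue (p ` {..m}) + measure lebesgue (\<Union>i\<in>I. {p i..p (Suc i)})"
      unfolding T_def using finI
      by (intro measure_Un_le) (auto simp: negligible_imp_sets negligible_finite)
    also have "measure lebesgue (p ` {..m}) = 0"
  by (intro negligible_imp_measure0 negligible_finite) auto
    also have "measure lebesgue (\<Union>i\<in>I. {p i..p (Suc i)}) \<le> (\<Sum>i\<in>I. measure lebesgue {p i..p (Suc i)})"
      using finI by (intro measure_UNION_le) auto
    also have "\<dots> = (\<Sum>i\<in>I. p (Suc i) - p i)"
      using mono by (intro sum.cong) (auto simp: I_def less_imp_le)
    also have "\<dots> \<le> (\<Sum>i\<in>I. (p (Suc i) - p i) * osc i / c)"
    proof (rule sum_mono)
      fix i assume "i \<in> I"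
      then have "p i < p (Suc i)" "c \<le> osc i" using mono by (auto simp: I_def)
      then have "(p (Suc i) - p i) * c \<le> (p (Suc i) - p i) * osc i"
        by (intro mult_left_mono) auto
      then show "p (Suc i) - p i \<le> (p (Suc i) - p i) * osc i / c"
        using c by (simp add: pos_le_divide_eq)
    qed
    also have "\<dots> \<le> (\<Sum>i<m. (p (Suc i) - p i) * osc i / c)"
    proof (rule sum_mono2)
      fix i assume "i \<in> {..<m} - I"
      then show "0 \<le> (p (Suc i) - p i) * osc i / c"
        using mono[of i] osc0[of i] c by simp
    qed (auto simp: I_def)
    also have "\<dots> < e"
      using sm c by (simp add: osc_def sum_divide_distrib[symmetric] field_simps)
    finally show "measure lebesgue T < e" by simp
  qed
qed

text \<open>At an interior discontinuity the variation stays above some \<open>1 / Suc n\<close>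
  arbitrarily close to the point, so countably many negligible sets suffice. The endpoints join the
  null set because \<open>isCont\<close> is two-sided and nothing is known of \<open>h\<close>
  outside \<open>{a..b}\<close>.\<close>

lemma riemann_integrable_AE_isCont:
  fixes h :: "real \<Rightarrow> real"
  assumes h: "riemann_integrable_on h a b" and "a < b"
  shows "AE x in lebesgue_on {a..b}. isCont h x"
proof -
  define D where "D c = {x\<in>{a<..<b}. \<forall>\<delta>>0. \<exists>y. \<bar>y - x\<bar> < \<delta> \<and> c \<le> \<bar>h y - h x\<bar>}" for c :: real
  have neg: "negligible ({a, b} \<union> (\<Union>n. D (1 / Suc n)))"
    unfolding D_def using riemann_integrable_osc_negligible[OF assms]
    by (intro negligible_Un negligible_countable_Union) (auto simp: negligible_finite)
  have sub: "x \<in> {a, b} \<union> (\<Union>n. D (1 / Suc n))" if "x \<in> {a..b}" "\<not> isCont h x" for x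
  proof (rule ccontr)
    assume n: "x \<notin> {a, b} \<union> (\<Union>n. D (1 / Suc n))"
    then have x: "x \<in> {a<..<b}" using that by auto
    have "isCont h x"
      unfolding continuous_at_eps_delta
    proof (intro allI impI)
      fix e :: real assume "0 < e"
      then obtain k where k: "1 / Suc k < e" using nat_approx_posE by blast
      have "x \<notin> D (1 / Suc k)" using n by blast
      then obtain \<delta> where "\<delta> > 0" "\<And>y. \<bar>y - x\<bar> < \<delta> \<Longrightarrow> \<bar>h y - h x\<bar> < 1 / Suc k"
        using x unfolding D_def by (auto simp: not_le)
      then show "\<exists>d>0. \<forall>x'. dist x' x < d \<longrightarrow> dist (h x') (h x) < e"
        using k by (metis less_trans dist_real_def)
    qed
    then show False using that by simp
  qed
  have "AE x in lebesgue. x \<notin> {a, b} \<union> (\<Union>n. D (1 / Suc n))"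
    using neg by (intro AE_not_in) (simp add: negligible_iff_null_sets)
  then have "AE x in lebesgue. x \<in> {a..b} \<longrightarrow> isCont h x"
    by eventually_elim (use sub in blast)
  then show ?thesis
    by (subst AE_restrict_space_iff) auto
qed

text \<open>On the set \<open>C\<close> of continuity points in \<open>S\<close> the function is
  continuous, hence measurable; the rest of \<open>S\<close> is null and Lebesgue measure is
  complete.\<close>

lemma AE_isCont_imp_borel_measurable:
  fixes u :: "real \<Rightarrow> real"
  assumes S: "S \<in> sets lebesgue" and u: "AE x in lebesgue_on S. isCont u x"
  shows "u \<in> borel_measurable (lebesgue_on S)"
proof -
  from u S have "AE x in lebesgue. x \<in> S \<longrightarrow> isCont u x"
    by (subst (asm) AE_restrict_space_iff) auto
  then have "AE x in lebesgue. x \<notin> {x \<in> S. \<not> isCont u x}" by eventually_elim auto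
  then have neg: "{x \<in> S. \<not> isCont u x} \<in> null_sets lebesgue"
    by (simp add: completion.AE_iff_null_sets)
  define C where "C = S - ({x \<in> S. \<not> isCont u x})"
  have C: "C \<in> sets lebesgue"
    unfolding C_def using neg S by auto
  have "continuous_on C u"
    by (auto simp: C_def intro!: continuous_at_imp_continuous_on)
  then have "u \<in> borel_measurable (lebesgue_on C)"
    using C by (rule continuous_imp_measurable_on_sets_lebesgue)
  then have m: "(\<lambda>x. if x \<in> C then u x else 0) \<in> borel_measurable lebesgue"
    using C by (simp add: borel_measurable_if)
  have "AE x in lebesgue. x \<notin> {x \<in> S. \<not> isCont u x}" using neg by (rule AE_not_in)
  then have "AE x in lebesgue. (if x \<in> C then u x else 0) = (if x \<in> S then u x else 0)"
    by eventually_elim (auto simp: C_def)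
  from borel_measurable_AE[OF m this] show ?thesis
    using S by (simp add: borel_measurable_if)
qed

section \<open>Approximation from below by continuous functions on the circle\<close>

lemma Lam_sets_lebesgue [simp]: "Lam \<in> sets lebesgue"
  by (simp add: Lam_def)

lemma finite_measure_Lam: "finite_measure (lebesgue_on Lam)"
  unfolding Lam_def by (rule finite_measure_lebesgue_on) (rule lmeasurable_interval)

lemma measure_Lam: "measure (lebesgue_on Lam) Lam = 2 * pi"
  by (simp add: Lam_def measure_restrict_space)

lemma Lint_const: "Lint (\<lambda>_. c) = 2 * pi * c"
  using measure_Lam by (simp add: Lint_def)

lemma L1_const: "L1 (\<lambda>_. c)"
  using finite_measure_Lam by (simp add: L1_def finite_measure.integrable_const)

lemma L1_bounded:
  assumes "u \<in> borel_measurable (lebesgue_on Lam)" "AE x in lebesgue_on Lam. \<bar>u x\<bar> \<le> B"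
  shows "L1 u"
  unfolding L1_def using assms
  by (intro finite_measure.integrable_const_bound[OF finite_measure_Lam, of _ B]) auto

lemma Lint_mono_AE:
  assumes "L1 u" "L1 v" "AE x in lebesgue_on Lam. u x \<le> v x"
  shows "Lint u \<le> Lint v"
  using assms unfolding L1_def Lint_def by (intro integral_mono_AE)

lemma AE_Lam_I: "(\<And>x. x \<in> Lam \<Longrightarrow> P x) \<Longrightarrow> AE x in lebesgue_on Lam. P x"
  by (rule AE_I2) simp

lemma L1_continuous: "continuous_on Lam u \<Longrightarrow> L1 u"
  unfolding L1_def Lam_def by (rule continuous_imp_integrable_real)

lemma Lint_nonneg: "(\<And>x. x \<in> Lam \<Longrightarrow> 0 \<le> u x) \<Longrightarrow> 0 \<le> Lint u"
  unfolding Lint_def by (intro integral_nonneg_AE AE_Lam_I)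

lemma L1_bounded_mult:
  assumes "k \<in> borel_measurable (lebesgue_on Lam)" "\<And>x. x \<in> Lam \<Longrightarrow> \<bar>k x\<bar> \<le> B" "L1 w"
  shows "L1 (\<lambda>x. k x * w x)"
  unfolding L1_def
proof (rule Bochner_Integration.integrable_bound[where f = "\<lambda>x. B * w x"])
  show "integrable (lebesgue_on Lam) (\<lambda>x. B * w x)" using assms(3) by (simp add: L1_def)
  have "w \<in> borel_measurable (lebesgue_on Lam)" using assms(3) by (auto simp: L1_def)
  then show "(\<lambda>x. k x * w x) \<in> borel_measurable (lebesgue_on Lam)" using assms(1) by simp
  show "AE x in lebesgue_on Lam. norm (k x * w x) \<le> norm (B * w x)"
  proof (rule AE_Lam_I)
    fix x assume "x \<in> Lam"
    then have "\<bar>k x\<bar> \<le> \<bar>B\<bar>" using assms(2) by fastforce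
    then show "norm (k x * w x) \<le> norm (B * w x)" by (simp add: abs_mult mult_right_mono)
  qed
qed

lemma L1_add: "L1 u \<Longrightarrow> L1 v \<Longrightarrow> L1 (\<lambda>x. u x + v x)"
  unfolding L1_def by (rule Bochner_Integration.integrable_add)

lemma Lint_add: "L1 u \<Longrightarrow> L1 v \<Longrightarrow> Lint (\<lambda>x. u x + v x) = Lint u + Lint v"
  unfolding L1_def Lint_def by (rule Bochner_Integration.integral_add)

lemma L1_diff: "L1 u \<Longrightarrow> L1 v \<Longrightarrow> L1 (\<lambda>x. u x - v x)"
  unfolding L1_def by (rule Bochner_Integration.integrable_diff)

lemma Lint_diff: "L1 u \<Longrightarrow> L1 v \<Longrightarrow> Lint (\<lambda>x. u x - v x) = Lint u - Lint v"
  unfolding L1_def Lint_def by (rule Bochner_Integration.integral_diff)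

lemma L1_cmult: "L1 u \<Longrightarrow> L1 (\<lambda>x. a * u x)"
  unfolding L1_def by simp

lemma Lint_cmult: "Lint (\<lambda>x. a * u x) = a * Lint u"
  unfolding Lint_def by simp

lemma L1_cong_AE:
  assumes "L1 v" "u \<in> borel_measurable (lebesgue_on Lam)" "AE x in lebesgue_on Lam. u x = v x"
  shows "L1 u" "Lint u = Lint v"
proof -
  have "v \<in> borel_measurable (lebesgue_on Lam)" using assms(1) by (auto simp: L1_def)
  then show "L1 u" "Lint u = Lint v"
    using assms integrable_cong_AE[of u "lebesgue_on Lam" v] integral_cong_AE[of u "lebesgue_on Lam" v]
    by (auto simp: L1_def Lint_def)
qed

lemma AE_Lam_interior: "AE x in lebesgue_on Lam. -pi < x \<and> x < pi"
proof -
  have "AE x in lebesgue. x \<notin> {-pi, pi}"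
    by (intro AE_not_in) (simp flip: negligible_iff_null_sets)
  then have "AE x in lebesgue. x \<in> Lam \<longrightarrow> -pi < x \<and> x < pi"
    by eventually_elim (auto simp: Lam_def)
  then show ?thesis by (subst AE_restrict_space_iff) auto
qed

lemma borel_measurable_Lam_cis:
  fixes \<phi> :: "complex \<Rightarrow> real"
  assumes "continuous_on (sphere 0 1) \<phi>"
  shows "(\<lambda>x. \<phi> (cis x)) \<in> borel_measurable (lebesgue_on Lam)"
proof (rule continuous_imp_measurable_on_sets_lebesgue)
  show "continuous_on Lam (\<lambda>x. \<phi> (cis x))"
    by (rule continuous_on_compose2[OF assms]) (auto intro!: continuous_intros)
qed simp

text \<open>Here \<open>y\<close> may be an endpoint: as \<open>x\<close> is interior, the distance
  is still below \<open>2 * pi\<close>. The only collision of \<open>cis\<close> on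
  \<open>Lam\<close>, between the two endpoints, is excluded.\<close>

lemma cis_inj_Lam_interior:
  assumes "cis x = cis y" "-pi < x" "x < pi" "y \<in> Lam"
  shows "x = y"
proof -
  have "cis (x - y) = 1" using assms(1) by (simp flip: cis_divide)
  then have "cos (x - y) = 1" by (metis cis.sel(1) one_complex.sel(1))
  then obtain n :: int where n: "x - y = n * 2 * pi"
    by (auto simp: cos_one_2pi_int)
  have "\<bar>x - y\<bar> < 2 * pi" using assms by (auto simp: Lam_def)
  then have "\<bar>real_of_int n\<bar> * (2 * pi) < 1 * (2 * pi)" by (simp add: n abs_mult)
  then have "\<bar>real_of_int n\<bar> < 1" by (subst (asm) mult_less_cancel_right) auto
  then have "n = 0" by linarith
  then show ?thesis using n by simp
qed

text \<open>The approximants are the inf-convolutions of \<open>u\<close> with multiples of the chordal distance; this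
  distance makes them functions on the circle although \<open>u\<close> need not be periodic.\<close>

lemma AE_isCont_lower_approx:
  fixes u :: "real \<Rightarrow> real"
  assumes bd: "\<And>x. x \<in> Lam \<Longrightarrow> \<bar>u x\<bar> \<le> B"
    and cont: "AE x in lebesgue_on Lam. isCont u x" and "0 < e"
  shows "\<exists>\<phi>::complex \<Rightarrow> real. continuous_on (sphere 0 1) \<phi> \<and> (\<forall>x\<in>Lam. \<phi> (cis x) \<le> u x) \<and>
           Lint u - e < Lint (\<lambda>x. \<phi> (cis x))"
proof -
  have B0: "0 \<le> B" using bd[of 0] by (auto simp: Lam_def)
  define \<phi> where "\<phi> n z = (INF y\<in>Lam. u y + real n * cmod (z - cis y))" for n z
  have ne: "Lam \<noteq> {}" by (auto simp: Lam_def)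
  have lower_term: "- B \<le> u y + real n * cmod (z - cis y)" if "y \<in> Lam" for y n z
    using bd[OF that] by (smt (verit) norm_ge_zero of_nat_0_le_iff zero_le_mult_iff)
  have bdd: "bdd_below ((\<lambda>y. u y + real n * cmod (z - cis y)) ` Lam)" for n z
    using lower_term by (intro bdd_belowI2) auto
  have upper: "\<phi> n z \<le> u y + real n * cmod (z - cis y)" if "y \<in> Lam" for n y z
    unfolding \<phi>_def using that by (intro cINF_lower bdd)
  have lower: "c \<le> \<phi> n z" if "\<And>y. y \<in> Lam \<Longrightarrow> c \<le> u y + real n * cmod (z - cis y)" for c n z
    unfolding \<phi>_def using that ne by (intro cINF_greatest)
  have lip: "\<phi> n z - real n * cmod (z - w) \<le> \<phi> n w" for n z w
  proof (rule lower)
    fix y assume y: "y \<in> Lam"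
    have "cmod (z - cis y) \<le> cmod (z - w) + cmod (w - cis y)"
      using norm_triangle_ineq[of "z - w" "w - cis y"] by simp
    then have "real n * cmod (z - cis y) \<le> real n * (cmod (z - w) + cmod (w - cis y))"
      by (intro mult_left_mono) auto
    then show "\<phi> n z - real n * cmod (z - w) \<le> u y + real n * cmod (w - cis y)"
      using upper[OF y, of n z] by (simp add: algebra_simps)
  qed
  have contphi: "continuous_on S (\<phi> n)" for n S
  proof (rule lipschitz_on_continuous_on)
    show "(real n)-lipschitz_on S (\<phi> n)"
    proof (rule lipschitz_onI)
      fix z w
      show "dist (\<phi> n z) (\<phi> n w) \<le> real n * dist z w"
        using lip[of n z w] lip[of n w z] by (auto simp: dist_norm norm_minus_commute abs_le_iff)
    qed simp
  qed
  have below: "\<phi> n (cis x) \<le> u x" if "x \<in> Lam" for n x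
    using upper[OF that, of n "cis x"] by simp
  have abs: "\<bar>\<phi> n (cis x)\<bar> \<le> B" if "x \<in> Lam" for n x
    using below[OF that, of n] bd[OF that] lower[of "-B" n "cis x"] lower_term by (auto simp: abs_le_iff)
  have lim: "(\<lambda>n. \<phi> n (cis x)) \<longlonglongrightarrow> u x" if x: "-pi < x" "x < pi" and c: "isCont u x" for x
  proof (rule LIMSEQ_I)
    fix r :: real assume r: "0 < r"
    have xL: "x \<in> Lam" using x by (auto simp: Lam_def)
    obtain \<delta> where \<delta>: "0 < \<delta>" "\<And>y. \<bar>y - x\<bar> < \<delta> \<Longrightarrow> \<bar>u y - u x\<bar> < r / 2"
      using c r unfolding continuous_at_eps_delta dist_real_def by (meson half_gt_zero)
    \<comment> \<open>By compactness, and since \<open>x\<close> is interior, points of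
      \<open>Lam\<close> outside the \<open>\<delta>\<close>-ball have \<open>cis\<close> at
      distance at least \<open>\<eta> > 0\<close> from \<open>cis x\<close>.\<close>
    have "compact (cis ` (Lam - ball x \<delta>))"
      by (intro compact_continuous_image compact_diff) (auto simp: Lam_def intro!: continuous_intros)
    moreover have "cis x \<notin> cis ` (Lam - ball x \<delta>)"
      using cis_inj_Lam_interior[OF _ x] \<delta>(1) by force
    ultimately obtain \<eta> where \<eta>: "0 < \<eta>" "\<And>y. y \<in> Lam - ball x \<delta> \<Longrightarrow> \<eta> \<le> dist (cis x) (cis y)"
      by (metis compact_imp_closed image_eqI separate_point_closed)
    \<comment> \<open>From this index on the penalty at far points outweighs \<open>2 * B\<close>,
      the largest possible drop of \<open>u\<close>, so that only points near \<open>x\<close> can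
      bring the infimum below \<open>u x\<close>.\<close>
    obtain N :: nat where N: "2 * B / \<eta> \<le> real N" using real_arch_simple by blast
    have "norm (\<phi> n (cis x) - u x) < r" if "N \<le> n" for n
    proof -
      have "2 * B / \<eta> \<le> real n" using N that by linarith
      then have n: "2 * B \<le> real n * \<eta>" using \<eta>(1) by (simp add: field_simps)
      have "u x - r / 2 \<le> \<phi> n (cis x)"
      proof (rule lower)
        fix y assume y: "y \<in> Lam"
        show "u x - r / 2 \<le> u y + real n * cmod (cis x - cis y)"
        proof (cases "y \<in> ball x \<delta>")
          case True
          then have "\<bar>u y - u x\<bar> < r / 2" using \<delta>(2) by (simp add: dist_real_def)
          moreover have "0 \<le> real n * cmod (cis x - cis y)" by simp
          ultimately show ?thesis by linarith
        next
          case False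
          then have "\<eta> \<le> cmod (cis x - cis y)" using \<eta>(2)[of y] y by (simp add: dist_norm)
          then have "real n * \<eta> \<le> real n * cmod (cis x - cis y)" by (intro mult_left_mono) auto
          then show ?thesis using n bd[OF y] bd[OF xL] r by linarith
        qed
      qed
      then show ?thesis using below[OF xL, of n] r by (simp add: abs_less_iff)
    qed
    then show "\<exists>N. \<forall>n\<ge>N. norm (\<phi> n (cis x) - u x) < r" by blast
  qed
  have "(\<lambda>n. Lint (\<lambda>x. \<phi> n (cis x))) \<longlonglongrightarrow> Lint u"
    unfolding Lint_def
  proof (rule integral_dominated_convergence[where w = "\<lambda>_. B"])
    show "u \<in> borel_measurable (lebesgue_on Lam)"
      using cont by (intro AE_isCont_imp_borel_measurable) auto
    show "(\<lambda>x. \<phi> n (cis x)) \<in> borel_measurable (lebesgue_on Lam)" for n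
      by (intro borel_measurable_Lam_cis contphi)
    show "AE x in lebesgue_on Lam. (\<lambda>n. \<phi> n (cis x)) \<longlonglongrightarrow> u x"
      using cont AE_Lam_interior by eventually_elim (use lim in blast)
    show "AE x in lebesgue_on Lam. norm (\<phi> n (cis x)) \<le> B" for n
      using abs by (intro AE_Lam_I) auto
    show "integrable (lebesgue_on Lam) (\<lambda>_. B)" using L1_const by (simp add: L1_def)
  qed
  then have "\<forall>\<^sub>F n in sequentially. Lint u - e < Lint (\<lambda>x. \<phi> n (cis x))"
    using \<open>0 < e\<close> by (intro order_tendstoD) auto
  then obtain n where "Lint u - e < Lint (\<lambda>x. \<phi> n (cis x))"
    by (auto simp: eventually_sequentially)
  then show ?thesis using contphi below by blast
qed

section \<open>Polynomials approximating an exponential from below\<close>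

text \<open>Since \<open>z * cnj z = 1\<close> on the circle, a power of \<open>z\<close> times a
  power of \<open>cnj z\<close> collapses to a power of one of them. The induction strips the
  constant terms of \<open>P\<close> and \<open>Q\<close> together, hence the arbitrary
  \<open>Q\<close>.\<close>

lemma poly_mult_cnj_on_circle:
  fixes P Q :: "complex poly"
  shows "\<exists>A B. \<forall>z. cmod z = 1 \<longrightarrow> poly P z * cnj (poly Q z) = poly A z + cnj (poly B z)"
proof (induction P arbitrary: Q)
  case 0
  show ?case by (rule exI[of _ 0], rule exI[of _ 0]) simp
next
  case (pCons a P)
  obtain b Q' where Q: "Q = pCons b Q'" by (cases Q)
  obtain A B where AB: "\<And>z. cmod z = 1 \<Longrightarrow> poly P z * cnj (poly Q' z) = poly A z + cnj (poly B z)"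
    using pCons.IH by blast
  have "poly (pCons a P) z * cnj (poly Q z) =
      poly (A + pCons (a * cnj b) (smult (cnj b) P)) z + cnj (poly (B + pCons 0 (smult (cnj a) Q')) z)"
    if z: "cmod z = 1" for z
  proof -
    have zz: "z * cnj z = 1" using z by (simp add: complex_norm_square[symmetric])
    have "poly (pCons a P) z * cnj (poly Q z) = a * cnj b + a * (cnj z * cnj (poly Q' z)) +
        cnj b * (z * poly P z) + (z * cnj z) * (poly P z * cnj (poly Q' z))"
      by (simp add: Q algebra_simps)
    then show ?thesis by (simp add: zz AB[OF z] algebra_simps)
  qed
  then show ?case by blast
qed

text \<open>Twice the product of real parts is \<open>Re (a * b) + Re (a * cnj b)\<close>, and the
  conjugate on \<open>B\<close> does not affect the real part. This is the closure under products
  that Stone-Weierstrass requires.\<close>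

lemma Re_poly_mult_on_circle:
  fixes P Q :: "complex poly"
  shows "\<exists>A. \<forall>z. cmod z = 1 \<longrightarrow> Re (poly P z) * Re (poly Q z) = Re (poly A z)"
proof -
  obtain A B where AB: "\<And>z. cmod z = 1 \<Longrightarrow> poly P z * cnj (poly Q z) = poly A z + cnj (poly B z)"
    using poly_mult_cnj_on_circle by blast
  have "Re (poly P z) * Re (poly Q z) = Re (poly (smult (1/2) (P * Q + A + B)) z)" if "cmod z = 1" for z
  proof -
    have "2 * (Re (poly P z) * Re (poly Q z)) = Re (poly P z * poly Q z) + Re (poly P z * cnj (poly Q z))"
      by simp
    also have "\<dots> = Re (poly (P * Q + A + B) z)" by (simp add: AB[OF that])
    finally show ?thesis by simp
  qed
  then show ?thesis by blast
qed

text \<open>Stone-Weierstrass for the functions that agree on the circle with the real part of a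
  polynomial; \<open>Re z\<close> and \<open>Im z = Re (- \<i> * z)\<close> separate points.\<close>

lemma Re_poly_dense_circle:
  fixes \<phi> :: "complex \<Rightarrow> real"
  assumes "continuous_on (sphere 0 1) \<phi>" "0 < e"
  shows "\<exists>A. \<forall>z\<in>sphere 0 1. \<bar>\<phi> z - Re (poly A z)\<bar> < e"
proof -
  define S where "S = sphere (0::complex) 1"
  define P where "P f \<longleftrightarrow> (\<exists>A. \<forall>z\<in>S. f z = Re (poly A z))" for f :: "complex \<Rightarrow> real"
  have "\<exists>g. P g \<and> (\<forall>z\<in>S. \<bar>\<phi> z - g z\<bar> < e)"
  proof (rule Stone_Weierstrass_HOL)
    show "compact S" by (simp add: S_def)
    show "P (\<lambda>_. c)" for c unfolding P_def by (rule exI[of _ "[:of_real c:]"]) simp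
    show "continuous_on S f" if Pf: "P f" for f
    proof -
      obtain A where A: "\<forall>z\<in>S. f z = Re (poly A z)" using Pf by (auto simp: P_def)
      have "continuous_on S (\<lambda>z. Re (poly A z))" by (intro continuous_intros)
      then show ?thesis using A continuous_on_cong by (metis (mono_tags, lifting))
    qed
    show "P (\<lambda>x. f x + g x)" if Pfg: "P f \<and> P g" for f g
    proof -
      obtain A B where "\<forall>z\<in>S. f z = Re (poly A z)" "\<forall>z\<in>S. g z = Re (poly B z)"
        using Pfg by (auto simp: P_def)
      then show ?thesis unfolding P_def by (intro exI[of _ "A + B"]) simp
    qed
    show "P (\<lambda>x. f x * g x)" if Pfg: "P f \<and> P g" for f g
    proof -
      obtain A B where "\<forall>z\<in>S. f z = Re (poly A z)" "\<forall>z\<in>S. g z = Re (poly B z)"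
        using Pfg by (auto simp: P_def)
      moreover obtain C where "\<And>z. cmod z = 1 \<Longrightarrow> Re (poly A z) * Re (poly B z) = Re (poly C z)"
        using Re_poly_mult_on_circle by blast
      ultimately show ?thesis unfolding P_def by (intro exI[of _ C]) (simp add: S_def)
    qed
    show "\<exists>f. P f \<and> f x \<noteq> f y" if "x \<in> S \<and> y \<in> S \<and> x \<noteq> y" for x y
    proof (cases "Re x = Re y")
      case False
      moreover have "P Re" unfolding P_def by (rule exI[of _ "[:0, 1:]"]) simp
      ultimately show ?thesis by blast
    next
      case True
      then have "Im x \<noteq> Im y" using that complex_eqI by blast
      moreover have "P Im" unfolding P_def by (rule exI[of _ "[:0, -\<i>:]"]) simp
      ultimately show ?thesis by blast
    qed
  qed (use assms in \<open>auto simp: S_def\<close>)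
  then show ?thesis by (fastforce simp: P_def S_def)
qed

section \<open>Means of polynomials over the circle\<close>

lemma Lint_Re_cis_power:
  "Lint (\<lambda>x. Re (c * cis x ^ Suc k)) = 0"
proof -
  define m where "m = real (Suc k)"
  have m: "m \<noteq> 0" by (simp add: m_def)
  define F where "F x = (Re c * sin (m * x) + Im c * cos (m * x)) / m" for x
  have eq: "Re (c * cis x ^ Suc k) = Re c * cos (m * x) - Im c * sin (m * x)" for x
    unfolding Complex.DeMoivre m_def by (simp del: of_nat_Suc)
  have "((\<lambda>x. Re c * cos (m * x) - Im c * sin (m * x)) has_integral (F pi - F (-pi))) {-pi..pi}"
  proof (rule fundamental_theorem_of_calculus)
    fix x
    have "(F has_real_derivative (Re c * cos (m * x) - Im c * sin (m * x))) (at x)"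
      unfolding F_def using m by (auto intro!: derivative_eq_intros simp: field_simps)
    then show "(F has_vector_derivative (Re c * cos (m * x) - Im c * sin (m * x))) (at x within {-pi..pi})"
      by (simp add: has_real_derivative_iff_has_vector_derivative has_vector_derivative_at_within)
  qed simp
  moreover have "F pi - F (-pi) = 0"
  proof -
    have "sin (m * pi) = 0" unfolding m_def by (rule sin_npi)
    then show ?thesis by (simp add: F_def)
  qed
  ultimately have "integral {-pi..pi} (\<lambda>x. Re (c * cis x ^ Suc k)) = 0"
    unfolding eq by (simp add: integral_unique)
  moreover have "L1 (\<lambda>x. Re (c * cis x ^ Suc k))"
    by (intro L1_continuous continuous_intros)
  ultimately show ?thesis
    unfolding Lint_def L1_def Lam_def by (simp add: lebesgue_integral_eq_integral)
qed

text \<open>The factor \<open>cis x ^ Suc k\<close> with arbitrary \<open>k\<close> makes the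
  induction close: peeling off a coefficient raises the exponent by one.\<close>

lemma Lint_Re_cis_power_poly:
  "Lint (\<lambda>x. Re (cis x ^ Suc k * poly A (cis x))) = 0"
proof (induction A arbitrary: k)
  case 0
  show ?case by (simp add: Lint_const)
next
  case (pCons a A)
  have "Lint (\<lambda>x. Re (cis x ^ Suc k * poly (pCons a A) (cis x))) =
      Lint (\<lambda>x. Re (a * cis x ^ Suc k) + Re (cis x ^ Suc (Suc k) * poly A (cis x)))"
    by (simp only: poly_pCons plus_complex.sel(1)[symmetric] algebra_simps power_Suc)
  also have "\<dots> = Lint (\<lambda>x. Re (a * cis x ^ Suc k)) + Lint (\<lambda>x. Re (cis x ^ Suc (Suc k) * poly A (cis x)))"
    by (intro Lint_add L1_continuous continuous_intros)
  also have "\<dots> = 0" by (simp only: Lint_Re_cis_power pCons.IH)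
  finally show ?case .
qed

text \<open>The mean value property of the harmonic function \<open>Re A\<close> at the centre of
  the disc: all nonconstant powers integrate to zero.\<close>

lemma Lint_Re_poly_cis: "Lint (\<lambda>x. Re (poly A (cis x))) = 2 * pi * Re (poly A 0)"
proof (cases A)
  case (pCons a A')
  have "Lint (\<lambda>x. Re (poly A (cis x))) = Lint (\<lambda>x. Re a + Re (cis x ^ Suc 0 * poly A' (cis x)))"
    by (simp add: pCons)
  also have "\<dots> = Lint (\<lambda>_. Re a) + Lint (\<lambda>x. Re (cis x ^ Suc 0 * poly A' (cis x)))"
    by (intro Lint_add L1_continuous continuous_intros)
  also have "\<dots> = 2 * pi * Re (poly A 0)"
    by (simp only: Lint_Re_cis_power_poly Lint_const) (simp add: pCons)
  finally show ?thesis .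
qed

text \<open>A Taylor section of \<open>exp\<close> composed with \<open>A\<close>. The error can be
  made relative because \<open>cmod (exp (poly A z))\<close> is at least \<open>exp (- R)\<close> on
  the closed disc; a relative error lets a mere rescaling push the polynomial below the exponential
  in modulus.\<close>

lemma exp_poly_approx:
  fixes A :: "complex poly"
  assumes "0 < e"
  shows "\<exists>q. \<forall>z. cmod z \<le> 1 \<longrightarrow> cmod (exp (poly A z) - poly q z) \<le> e * cmod (exp (poly A z))"
proof -
  obtain R where R: "0 < R" "\<And>z. cmod z \<le> 1 \<Longrightarrow> cmod (poly A z) \<le> R"
    using poly_bound_exists[of 1 A] by blast
  have "(\<lambda>n. inverse (fact n) * R ^ n) \<longlonglongrightarrow> 0"
    by (rule summable_LIMSEQ_zero[OF summable_exp])
  then have "(\<lambda>n. exp R * R * (inverse (fact n) * R ^ n)) \<longlonglongrightarrow> exp R * R * 0"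
    by (intro tendsto_intros)
  then have "\<forall>\<^sub>F n in sequentially. exp R * R * (inverse (fact n) * R ^ n) < e * exp (- R)"
    using assms by (intro order_tendstoD) auto
  then obtain n where n: "exp R * R * (inverse (fact n) * R ^ n) < e * exp (- R)"
    by (auto simp: eventually_sequentially)
  define q where "q = (\<Sum>i\<le>n. smult (1 / fact i) (A ^ i))"
  have "cmod (exp (poly A z) - poly q z) \<le> e * cmod (exp (poly A z))" if z: "cmod z \<le> 1" for z
  proof -
    define w where "w = poly A z"
    have w: "cmod w \<le> R" using R z by (simp add: w_def)
    have q: "poly q z = (\<Sum>i\<le>n. w ^ i / fact i)" by (simp add: q_def poly_sum w_def poly_power)
    have "cmod (exp w - (\<Sum>i\<le>n. w ^ i / fact i)) \<le> exp (cmod w) * cmod w ^ Suc n / fact n"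
      by (rule Taylor_exp_field)
    also have "\<dots> \<le> exp R * R ^ Suc n / fact n"
      using w by (intro divide_right_mono mult_mono power_mono) auto
    also have "\<dots> \<le> e * exp (- R)" using n by (simp add: field_simps)
    also have "\<dots> \<le> e * cmod (exp w)"
      using w assms abs_Re_le_cmod[of w] by (intro mult_left_mono) (auto simp: norm_exp_eq_Re)
    finally show ?thesis unfolding q w_def[symmetric] .
  qed
  then show ?thesis by blast
qed

text \<open>The squared modulus of \<open>exp (A / 2)\<close> is \<open>exp (Re A)\<close>, and the
  mean of \<open>Re A\<close> is its value at 0. Hence a good approximation of \<open>u\<close> from
  below by \<open>Re A\<close> controls both the bound on the circle and the value at 0.\<close>

lemma poly_approx_exp_from_below:
  fixes u :: "real \<Rightarrow> real"
  assumes bd: "\<And>x. x \<in> Lam \<Longrightarrow> \<bar>u x\<bar> \<le> B"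
    and cont: "AE x in lebesgue_on Lam. isCont u x" and "0 < \<delta>"
  shows "\<exists>q. (\<forall>x\<in>Lam. (cmod (poly q (cis x)))\<^sup>2 \<le> exp (u x)) \<and>
           exp (Lint u / (2 * pi) - \<delta>) \<le> (cmod (poly q 0))\<^sup>2"
proof -
  \<comment> \<open>One quarter is spent on the continuous minorant, two on passing from it to
    \<open>Re A\<close>, and one on the Taylor polynomial.\<close>
  define d where "d = \<delta> / 4"
  have d: "0 < d" using \<open>0 < \<delta>\<close> by (simp add: d_def)
  have "0 < 2 * pi * d" using d by simp
  from AE_isCont_lower_approx[OF bd cont this] obtain \<phi> :: "complex \<Rightarrow> real"
    where \<phi>: "continuous_on (sphere 0 1) \<phi>" "\<And>x. x \<in> Lam \<Longrightarrow> \<phi> (cis x) \<le> u x"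
      "Lint u - 2 * pi * d < Lint (\<lambda>x. \<phi> (cis x))" by blast
  \<comment> \<open>Shifting down by \<open>d\<close> before approximating within \<open>d\<close>
    makes the approximation one-sided.\<close>
  have "continuous_on (sphere 0 1) (\<lambda>z. \<phi> z - d)" by (intro continuous_intros \<phi>)
  from Re_poly_dense_circle[OF this d] obtain A
    where A: "\<And>z. z \<in> sphere 0 1 \<Longrightarrow> \<bar>\<phi> z - d - Re (poly A z)\<bar> < d" by blast
  have A1: "Re (poly A (cis x)) \<le> \<phi> (cis x)" "\<phi> (cis x) \<le> Re (poly A (cis x)) + 2 * d" for x
    using A[of "cis x"] by (auto simp: abs_less_iff)
  have "Lint (\<lambda>x. \<phi> (cis x)) \<le> Lint (\<lambda>x. Re (poly A (cis x)) + 2 * d)"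
  proof (rule Lint_mono_AE)
    show "L1 (\<lambda>x. \<phi> (cis x))"
      by (intro L1_continuous continuous_on_compose2[OF \<phi>(1)]) (auto intro!: continuous_intros)
  qed (auto intro!: L1_continuous continuous_intros A1)
  also have "\<dots> = 2 * pi * Re (poly A 0) + 2 * pi * (2 * d)"
    by (subst Lint_add) (auto intro!: L1_continuous continuous_intros simp: Lint_Re_poly_cis Lint_const)
  finally have "Lint u \<le> 2 * pi * (Re (poly A 0) + 3 * d)"
    using \<phi>(3) by (simp add: algebra_simps)
  then have A0: "Lint u / (2 * pi) \<le> Re (poly A 0) + 3 * d"
    by (simp add: field_simps)
  \<comment> \<open>So that \<open>exp (- d / 2) = 1 - 2 * \<epsilon>\<close>, which is at most
    \<open>(1 - \<epsilon>) / (1 + \<epsilon>)\<close>.\<close>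
  define \<epsilon> where "\<epsilon> = (1 - exp (- d / 2)) / 2"
  have \<epsilon>: "0 < \<epsilon>" using d by (simp add: \<epsilon>_def)
  from exp_poly_approx[OF \<epsilon>, of "smult (1/2) A"] obtain q0
    where q0: "\<And>z. cmod z \<le> 1 \<Longrightarrow>
      cmod (exp (poly A z / 2) - poly q0 z) \<le> \<epsilon> * cmod (exp (poly A z / 2))"
    by auto
  \<comment> \<open>Division by \<open>1 + \<epsilon>\<close> turns the relative error bound into
    domination by the modulus of \<open>exp (A / 2)\<close>.\<close>
  define q where "q = smult (of_real (1 / (1 + \<epsilon>))) q0"
  have q: "cmod (poly q z) = cmod (poly q0 z) / (1 + \<epsilon>)" for z
    unfolding q_def poly_smult norm_mult norm_of_real using \<epsilon> by simp
  have E: "(cmod (exp (w / 2)))\<^sup>2 = exp (Re w)" for w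
    by (simp add: norm_exp_eq_Re flip: exp_double)
  have "(cmod (poly q (cis x)))\<^sup>2 \<le> exp (u x)" if x: "x \<in> Lam" for x
  proof -
    have "cmod (poly q0 (cis x)) \<le> (1 + \<epsilon>) * cmod (exp (poly A (cis x) / 2))"
      using q0[of "cis x"] norm_triangle_ineq2[of "poly q0 (cis x)" "exp (poly A (cis x) / 2)"]
      by (simp add: algebra_simps norm_minus_commute)
    then have "cmod (poly q (cis x)) \<le> cmod (exp (poly A (cis x) / 2))"
      using \<epsilon> by (simp add: q field_simps)
    then have "(cmod (poly q (cis x)))\<^sup>2 \<le> (cmod (exp (poly A (cis x) / 2)))\<^sup>2"
      by (intro power_mono) auto
    also have "\<dots> \<le> exp (u x)" unfolding E using A1[of x] \<phi>(2)[OF x] by simp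
    finally show ?thesis .
  qed
  moreover have "exp (Lint u / (2 * pi) - \<delta>) \<le> (cmod (poly q 0))\<^sup>2"
  proof -
    have "(1 - \<epsilon>) * cmod (exp (poly A 0 / 2)) \<le> cmod (poly q0 0)"
      using q0[of 0] norm_triangle_ineq2[of "exp (poly A 0 / 2)" "poly q0 0"]
      by (simp add: algebra_simps)
    moreover have "exp (- d / 2) * (1 + \<epsilon>) \<le> 1 - \<epsilon>"
    proof -
      have e: "exp (- d / 2) = 1 - 2 * \<epsilon>" by (simp add: \<epsilon>_def field_simps)
      have "exp (- d / 2) * (1 + \<epsilon>) = 1 - \<epsilon> - 2 * \<epsilon>\<^sup>2"
        unfolding e by (simp add: algebra_simps power2_eq_square)
      then show ?thesis by simp
    qed
    ultimately have "exp (- d / 2) * (1 + \<epsilon>) * cmod (exp (poly A 0 / 2)) \<le> cmod (poly q0 0)"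
      by (meson mult_right_mono norm_ge_zero order_trans)
    then have "exp (- d / 2) * cmod (exp (poly A 0 / 2)) \<le> cmod (poly q 0)"
      using \<epsilon> by (simp add: q field_simps)
    then have "(exp (- d / 2) * cmod (exp (poly A 0 / 2)))\<^sup>2 \<le> (cmod (poly q 0))\<^sup>2"
      by (intro power_mono) auto
    moreover have "(exp (- d / 2) * cmod (exp (poly A 0 / 2)))\<^sup>2 = exp (Re (poly A 0) - d)"
      unfolding power_mult_distrib E by (simp add: exp_diff exp_minus field_simps flip: exp_double)
    moreover have "exp (Lint u / (2 * pi) - \<delta>) \<le> exp (Re (poly A 0) - d)"
      using A0 by (simp add: d_def)
    ultimately show ?thesis by linarith
  qed
  ultimately show ?thesis by blast
qed

section \<open>Jensen's formula for reflected polynomials\<close>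

text \<open>There is at most one interior preimage of \<open>w\<close> under \<open>cis\<close>, and
  the endpoints of \<open>Lam\<close> are null.\<close>

lemma AE_cis_neq: "AE x in lebesgue_on Lam. cis x \<noteq> w"
proof (cases "\<exists>y\<in>Lam. -pi < y \<and> y < pi \<and> cis y = w")
  case False
  show ?thesis using AE_Lam_interior by eventually_elim (use False in \<open>auto simp: Lam_def\<close>)
next
  case True
  then obtain y where y: "y \<in> Lam" "cis y = w" by blast
  have "AE x in lebesgue. x \<notin> {y}"
    by (intro AE_not_in) (simp flip: negligible_iff_null_sets)
  then have "AE x in lebesgue_on Lam. x \<noteq> y" by (subst AE_restrict_space_iff) auto
  with AE_Lam_interior show ?thesis
    by eventually_elim (metis y cis_inj_Lam_interior)
qed

lemma AE_poly_cis_nonzero: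
  fixes P :: "complex poly"
  assumes "P \<noteq> 0"
  shows "AE x in lebesgue_on Lam. poly P (cis x) \<noteq> 0"
proof -
  have "AE x in lebesgue_on Lam. \<forall>w\<in>{w. poly P w = 0}. cis x \<noteq> w"
    using AE_cis_neq poly_roots_finite[OF assms] by (subst AE_finite_all) auto
  then show ?thesis by eventually_elim auto
qed

text \<open>The integrand is the real part of the logarithm of \<open>1 - b * z\<close>, whose
  Taylor sections are polynomials vanishing at 0 and so have mean zero. The geometric series in
  \<open>cmod b\<close> dominates them.\<close>

lemma Lint_ln_cmod_one_minus_lt:
  assumes b: "cmod b < 1"
  shows "L1 (\<lambda>x. ln (cmod (1 - b * cis x)))" "Lint (\<lambda>x. ln (cmod (1 - b * cis x))) = 0"
proof -
  have ne: "1 - b * cis x \<noteq> 0" for x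
    using b by (metis eq_iff_diff_eq_0 less_irrefl mult.right_neutral norm_cis norm_mult norm_one)
  have cont: "continuous_on Lam (\<lambda>x. ln (cmod (1 - b * cis x)))"
    using ne by (intro continuous_intros) auto
  then show "L1 (\<lambda>x. ln (cmod (1 - b * cis x)))" by (rule L1_continuous)
  \<comment> \<open>The summand for \<open>n = 0\<close> is zero because division by zero yields
    zero, so there is no constant term.\<close>
  define p where "p N = (\<Sum>n<N. monom (- (b ^ n) / of_nat n) n)" for N
  have poly: "poly (p N) (cis x) = (\<Sum>n<N. - ((b * cis x) ^ n) / of_nat n)" for N x
    by (simp add: p_def poly_sum poly_monom power_mult_distrib)
  have p0: "poly (p N) 0 = 0" for N
  proof -
    have "coeff (p N) 0 = (\<Sum>n<N. 0)"
      unfolding p_def coeff_sum by (rule sum.cong) auto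
    then show ?thesis by (simp add: poly_0_coeff_0)
  qed
  have "(\<lambda>N. Lint (\<lambda>x. Re (poly (p N) (cis x)))) \<longlonglongrightarrow> Lint (\<lambda>x. ln (cmod (1 - b * cis x)))"
    unfolding Lint_def
  proof (rule integral_dominated_convergence[where w = "\<lambda>_. 1 / (1 - cmod b)"])
    show "(\<lambda>x. ln (cmod (1 - b * cis x))) \<in> borel_measurable (lebesgue_on Lam)"
      using cont by (rule continuous_imp_measurable_on_sets_lebesgue) simp
    show "(\<lambda>x. Re (poly (p N) (cis x))) \<in> borel_measurable (lebesgue_on Lam)" for N
      by (intro continuous_imp_measurable_on_sets_lebesgue continuous_intros) simp
    show "integrable (lebesgue_on Lam) (\<lambda>_. 1 / (1 - cmod b))" using L1_const by (simp add: L1_def)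
    show "AE x in lebesgue_on Lam. (\<lambda>N. Re (poly (p N) (cis x))) \<longlonglongrightarrow> ln (cmod (1 - b * cis x))"
    proof (rule AE_Lam_I)
      fix x
      have "(\<lambda>n. - ((- (- b * cis x)) ^ n) / of_nat n) sums ln (1 + - b * cis x)"
        using b by (intro Ln_series') (simp add: norm_mult)
      then have "(\<lambda>N. poly (p N) (cis x)) \<longlonglongrightarrow> ln (1 - b * cis x)"
        unfolding sums_def poly by simp
      then have "(\<lambda>N. Re (poly (p N) (cis x))) \<longlonglongrightarrow> Re (ln (1 - b * cis x))"
        by (rule tendsto_Re)
      then show "(\<lambda>N. Re (poly (p N) (cis x))) \<longlonglongrightarrow> ln (cmod (1 - b * cis x))"
        using ne[of x] by simp
    qed
    show "AE x in lebesgue_on Lam. norm (Re (poly (p N) (cis x))) \<le> 1 / (1 - cmod b)" for N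
    proof (rule AE_Lam_I)
      fix x
      have "norm (Re (poly (p N) (cis x))) \<le> cmod (poly (p N) (cis x))"
        by (simp add: abs_Re_le_cmod)
      also have "\<dots> \<le> (\<Sum>n<N. cmod b ^ n)"
        unfolding poly
      proof (rule sum_norm_le)
        fix n
        show "cmod (- ((b * cis x) ^ n) / of_nat n) \<le> cmod b ^ n"
        proof (cases n)
          case (Suc k)
          have "cmod b ^ Suc k / real (Suc k) \<le> cmod b ^ Suc k / 1"
            by (intro divide_left_mono) auto
          then show ?thesis
            by (simp add: Suc norm_divide norm_power norm_mult del: of_nat_Suc power_Suc)
        qed simp
      qed
      also have "\<dots> \<le> (\<Sum>n. cmod b ^ n)"
        using b by (intro sum_le_suminf summable_geometric) auto
      also have "\<dots> = 1 / (1 - cmod b)" using b by (simp add: suminf_geometric)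
      finally show "norm (Re (poly (p N) (cis x))) \<le> 1 / (1 - cmod b)" .
    qed
  qed
  then show "Lint (\<lambda>x. ln (cmod (1 - b * cis x))) = 0"
    by (simp add: Lint_Re_poly_cis p0 LIMSEQ_const_iff)
qed

text \<open>Both sides equal \<open>1 - 2 * r * Re w + r^2\<close>. For positive \<open>r\<close>
  the identity bounds \<open>1 - w\<close> by \<open>1 - r * w\<close>, which moves a zero off the
  circle.\<close>

lemma cmod_one_minus_scaled:
  assumes "cmod w = 1"
  shows "(cmod (1 - of_real r * w))\<^sup>2 = (1 - r)\<^sup>2 + r * (cmod (1 - w))\<^sup>2"
proof -
  have "(Re w)\<^sup>2 + (Im w)\<^sup>2 = 1" using assms by (simp add: cmod_power2[symmetric])
  then show ?thesis
    unfolding cmod_power2 by simp algebra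
qed

text \<open>Fatou along \<open>r n * b\<close>: the functions \<open>w n\<close> are nonnegative and
  all have integral \<open>2 * pi * ln 2\<close>. This reaches the case \<open>cmod b = 1\<close>,
  where the logarithm is unbounded below.\<close>

lemma L1_ln_cmod_one_minus:
  assumes b: "cmod b \<le> 1"
  shows "L1 (\<lambda>x. ln (cmod (1 - b * cis x)))"
proof -
  define r where "r n = 1 - inverse (real (Suc n))" for n
  have r01: "0 \<le> r n" "r n < 1" for n
    by (auto simp: r_def inverse_le_1_iff)
  have rlim: "r \<longlonglongrightarrow> 1 - 0"
    unfolding r_def by (intro tendsto_intros LIMSEQ_inverse_real_of_nat)
  define w where "w n x = ln 2 - ln (cmod (1 - (of_real (r n) * b) * cis x))" for n x
  define v where "v x = ln 2 - ln (cmod (1 - b * cis x))" for x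
  have meas: "(\<lambda>x. ln (cmod (1 - c * cis x))) \<in> borel_measurable (lebesgue_on Lam)" for c
  proof -
    have "(\<lambda>x. cmod (1 - c * cis x)) \<in> borel_measurable (lebesgue_on Lam)"
      by (intro continuous_imp_measurable_on_sets_lebesgue continuous_intros) simp
    then show ?thesis by measurable
  qed
  \<comment> \<open>At a zero of \<open>1 - c * cis x\<close> the bound survives through the
    convention \<open>ln 0 = 0\<close>.\<close>
  have le2: "ln (cmod (1 - c * cis x)) \<le> ln 2" if "cmod c \<le> 1" for c x
  proof (cases "1 - c * cis x = 0")
    case False
    moreover have "cmod (1 - c * cis x) \<le> 2"
      using norm_triangle_ineq4[of 1 "c * cis x"] that by (simp add: norm_mult)
    ultimately show ?thesis by (subst ln_le_cancel_iff) auto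
  qed simp
  have rb: "cmod (of_real (r n) * b) < 1" for n
    using r01[of n] b by (simp add: norm_mult) (meson le_less_trans mult_left_le)
  have wm: "w n \<in> borel_measurable (lebesgue_on Lam)" for n
    unfolding w_def by (intro borel_measurable_diff borel_measurable_const meas)
  have w0: "0 \<le> w n x" for n x using le2[of "of_real (r n) * b" x] rb[of n] by (simp add: w_def)
  have v0: "0 \<le> v x" for x using le2[OF b] by (simp add: v_def)
  have wint: "integrable (lebesgue_on Lam) (w n)" "integral\<^sup>L (lebesgue_on Lam) (w n) = 2 * pi * ln 2" for n
    using Lint_ln_cmod_one_minus_lt[OF rb[of n]] L1_const[of "ln 2"] Lint_const[of "ln 2"]
    unfolding w_def L1_def Lint_def by auto
  have "AE x in lebesgue_on Lam. poly [:1, - b:] (cis x) \<noteq> 0"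
    by (rule AE_poly_cis_nonzero) simp
  then have "AE x in lebesgue_on Lam. ennreal (v x) = liminf (\<lambda>n. ennreal (w n x))"
  proof eventually_elim
    case (elim x)
    then have "1 - b * cis x \<noteq> 0" by (simp add: mult.commute)
    then have "(\<lambda>n. w n x) \<longlonglongrightarrow> ln 2 - ln (cmod (1 - (of_real (1 - 0) * b) * cis x))"
      unfolding w_def by (intro tendsto_intros rlim) auto
    then have "(\<lambda>n. ennreal (w n x)) \<longlonglongrightarrow> ennreal (v x)"
      by (intro tendsto_ennrealI) (simp add: v_def)
    then show ?case by (simp add: lim_imp_Liminf)
  qed
  then have "(\<integral>\<^sup>+x. ennreal (v x) \<partial>lebesgue_on Lam) = (\<integral>\<^sup>+x. liminf (\<lambda>n. ennreal (w n x)) \<partial>lebesgue_on Lam)"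
    by (rule nn_integral_cong_AE)
  also have "\<dots> \<le> liminf (\<lambda>n. \<integral>\<^sup>+x. ennreal (w n x) \<partial>lebesgue_on Lam)"
    using wm by (intro nn_integral_liminf) measurable
  also have "\<dots> = liminf (\<lambda>n. ennreal (2 * pi * ln 2))"
    using wint w0 by (simp add: nn_integral_eq_integral)
  also have "\<dots> < \<infinity>" by (simp add: Liminf_const)
  finally have "integrable (lebesgue_on Lam) v"
    using v0 meas unfolding v_def by (intro integrableI_nonneg) auto
  then have "integrable (lebesgue_on Lam) (\<lambda>x. ln 2 - v x)"
    using L1_const[of "ln 2"] unfolding L1_def by (intro Bochner_Integration.integrable_diff)
  then show ?thesis by (simp add: v_def L1_def)
qed

text \<open>For \<open>cmod b = 1\<close> the comparison is with \<open>r * b\<close>,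
  \<open>r < 1\<close>, where the integral is zero: the scaling identity costs only
  \<open>- ln r / 2\<close> in the logarithm.\<close>

lemma Lint_ln_cmod_one_minus_le:
  assumes b: "cmod b \<le> 1"
  shows "Lint (\<lambda>x. ln (cmod (1 - b * cis x))) \<le> 0"
proof (cases "cmod b < 1")
  case True
  then show ?thesis by (simp add: Lint_ln_cmod_one_minus_lt)
next
  case False
  then have b1: "cmod b = 1" using b by simp
  show ?thesis
  proof (rule field_le_epsilon)
    fix e :: real assume e: "0 < e"
    \<comment> \<open>Then \<open>- ln r / 2 = e / (2 * pi)\<close>, which integrates to
      \<open>e\<close> over \<open>Lam\<close>.\<close>
    define r where "r = exp (- e / pi)"
    have r: "0 < r" "r < 1" using e by (auto simp: r_def)
    have rb: "cmod (of_real r * b) < 1" using r by (simp add: norm_mult b1)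
    have "AE x in lebesgue_on Lam. poly [:1, - b:] (cis x) \<noteq> 0"
      by (rule AE_poly_cis_nonzero) simp
    then have le: "AE x in lebesgue_on Lam. ln (cmod (1 - b * cis x)) \<le> ln (cmod (1 - of_real r * b * cis x)) + e / (2 * pi)"
    proof eventually_elim
      case (elim x)
      then have ne: "0 < cmod (1 - b * cis x)" by (simp add: mult.commute)
      have "r * (cmod (1 - b * cis x))\<^sup>2 \<le> (cmod (1 - of_real r * (b * cis x)))\<^sup>2"
        by (subst cmod_one_minus_scaled) (auto simp: norm_mult b1)
      then have le: "r * (cmod (1 - b * cis x))\<^sup>2 \<le> (cmod (1 - of_real r * b * cis x))\<^sup>2"
        by (simp add: mult.assoc)
      moreover have pos: "0 < r * (cmod (1 - b * cis x))\<^sup>2" using r ne by simp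
      ultimately have "ln (r * (cmod (1 - b * cis x))\<^sup>2) \<le> ln ((cmod (1 - of_real r * b * cis x))\<^sup>2)"
        by (subst ln_le_cancel_iff) auto
      moreover have "0 < cmod (1 - of_real r * b * cis x)"
        using le pos by (metis less_le_trans norm_eq_zero norm_ge_zero order_less_le zero_less_power2)
      ultimately have "ln r + 2 * ln (cmod (1 - b * cis x)) \<le> 2 * ln (cmod (1 - of_real r * b * cis x))"
        using r ne by (simp add: ln_mult ln_realpow)
      then show ?case by (simp add: r_def field_simps)
    qed
    have "Lint (\<lambda>x. ln (cmod (1 - b * cis x))) \<le> Lint (\<lambda>x. ln (cmod (1 - of_real r * b * cis x)) + e / (2 * pi))"
      by (intro Lint_mono_AE[OF _ _ le] L1_add L1_const L1_ln_cmod_one_minus b less_imp_le[OF rb])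
    also have "\<dots> = 0 + e"
      by (subst Lint_add) (auto simp: Lint_ln_cmod_one_minus_lt[OF rb] L1_const Lint_const)
    finally show "Lint (\<lambda>x. ln (cmod (1 - b * cis x))) \<le> 0 + e" .
  qed
qed

text \<open>For \<open>a\<close> in the open disc, \<open>z * cnj z = 1\<close> gives
  \<open>b = cnj a\<close> and \<open>c = 1\<close>; otherwise \<open>a\<close> is factored out and
  \<open>b = 1 / a\<close>. In both cases \<open>1 - b * z\<close> has no zero in the open
  disc.\<close>

lemma reflect_root:
  fixes a :: complex
  shows "\<exists>b c. cmod b \<le> 1 \<and> 0 < c \<and> (\<forall>z. cmod z = 1 \<longrightarrow> cmod (z - a) = c * cmod (1 - b * z))"
proof (cases "cmod a < 1")
  case True
  have "cmod (z - a) = 1 * cmod (1 - cnj a * z)" if "cmod z = 1" for z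
  proof -
    have "z * cnj z = 1" using that by (simp add: complex_norm_square[symmetric])
    then have "z - a = z * cnj (1 - cnj a * z)" by (simp add: algebra_simps)
    then have "cmod (z - a) = cmod z * cmod (1 - cnj a * z)" by (metis complex_mod_cnj norm_mult)
    then show ?thesis using that by simp
  qed
  then show ?thesis using True by (intro exI[of _ "cnj a"] exI[of _ 1]) auto
next
  case False
  then have a: "a \<noteq> 0" by auto
  have "cmod (z - a) = cmod a * cmod (1 - (1 / a) * z)" for z
  proof -
    have "z - a = - a * (1 - (1 / a) * z)" using a by (simp add: field_simps)
    then show ?thesis by (metis norm_minus_cancel norm_mult)
  qed
  moreover have "cmod (1 / a) \<le> 1" using False by (simp add: norm_divide divide_le_eq)
  ultimately show ?thesis using a by (intro exI[of _ "1 / a"] exI[of _ "cmod a"]) auto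
qed

text \<open>\<open>R\<close> is \<open>P\<close> with its zeros in the open disc reflected in the circle; for such \<open>R\<close> Jensen's
  inequality holds in the direction that fails in general.\<close>

lemma outer_poly_exists:
  fixes P :: "complex poly"
  assumes "P \<noteq> 0"
  shows "\<exists>R. poly R 0 \<noteq> 0 \<and> (\<forall>z. cmod z = 1 \<longrightarrow> cmod (poly P z) = cmod (poly R z)) \<and>
     L1 (\<lambda>x. ln (cmod (poly P (cis x)))) \<and>
     Lint (\<lambda>x. ln (cmod (poly P (cis x)))) \<le> 2 * pi * ln (cmod (poly R 0))"
  using assms
proof (induction "degree P" arbitrary: P)
  case 0
  then obtain c where "P = [:c:]" by (metis degree_eq_zeroE)
  then show ?case using 0 by (intro exI[of _ P]) (simp add: L1_const Lint_const)
next
  case (Suc n)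
  have "\<not> constant (poly P)" using Suc.hyps(2) by (simp add: constant_degree)
  then obtain a where "poly P a = 0" using fundamental_theorem_of_algebra by blast
  then obtain P' where P': "P = [:-a, 1:] * P'" by (metis dvdE poly_eq_0_iff_dvd)
  have P'0: "P' \<noteq> 0" using P' Suc.prems by auto
  have "degree P = Suc (degree P')" using P'0 unfolding P' by (subst degree_mult_eq) auto
  with Suc.hyps(1)[of P'] Suc.hyps(2) P'0 obtain R' where R': "poly R' 0 \<noteq> 0"
      "\<And>z. cmod z = 1 \<Longrightarrow> cmod (poly P' z) = cmod (poly R' z)"
      "L1 (\<lambda>x. ln (cmod (poly P' (cis x))))"
      "Lint (\<lambda>x. ln (cmod (poly P' (cis x)))) \<le> 2 * pi * ln (cmod (poly R' 0))"
    by auto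
  obtain b c where bc: "cmod b \<le> 1" "0 < c" "\<And>z. cmod z = 1 \<Longrightarrow> cmod (z - a) = c * cmod (1 - b * z)"
    using reflect_root by blast
  define R where "R = smult (of_real c) [:1, - b:] * R'"
  have R0: "cmod (poly R 0) = c * cmod (poly R' 0)" using bc by (simp add: R_def norm_mult)
  have PP': "cmod (poly P z) = cmod (z - a) * cmod (poly P' z)" for z
    unfolding norm_mult[symmetric] P' by (simp add: algebra_simps)
  have PR: "cmod (poly P z) = cmod (poly R z)" if "cmod z = 1" for z
  proof -
    have "poly R z = of_real c * ((1 - b * z) * poly R' z)" by (simp add: R_def algebra_simps)
    then have "cmod (poly R z) = cmod (z - a) * cmod (poly P' z)"
      using bc R'(2)[OF that] that by (simp add: norm_mult)
    then show ?thesis by (simp only: PP')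
  qed
  \<comment> \<open>Almost everywhere \<open>ln (cmod (poly P (cis x)))\<close> splits into these
    terms. The middle one has mean at most zero, and the means of the others add up to at most
    \<open>ln c + ln (cmod (poly R' 0))\<close>, the logarithm of the modulus of \<open>R\<close> at
    0.\<close>
  define k where "k x = ln c + (ln (cmod (1 - b * cis x)) + ln (cmod (poly P' (cis x))))" for x
  have L1k: "L1 k" and Lintk: "Lint k \<le> 2 * pi * ln (cmod (poly R 0))"
  proof -
    have L: "L1 (\<lambda>x. ln (cmod (1 - b * cis x)) + ln (cmod (poly P' (cis x))))"
      by (rule L1_add[OF L1_ln_cmod_one_minus[OF bc(1)] R'(3)])
    then show "L1 k" unfolding k_def by (rule L1_add[OF L1_const])
    have "Lint k = 2 * pi * ln c + (Lint (\<lambda>x. ln (cmod (1 - b * cis x))) + Lint (\<lambda>x. ln (cmod (poly P' (cis x)))))"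
      unfolding k_def using L R'(3) L1_ln_cmod_one_minus[OF bc(1)] by (simp add: Lint_add L1_const Lint_const)
    also have "\<dots> \<le> 2 * pi * ln c + 2 * pi * ln (cmod (poly R' 0))"
      using Lint_ln_cmod_one_minus_le[OF bc(1)] R'(4) by linarith
    also have "\<dots> = 2 * pi * ln (cmod (poly R 0))"
      using bc R'(1) by (simp add: R0 ln_mult algebra_simps)
    finally show "Lint k \<le> 2 * pi * ln (cmod (poly R 0))" .
  qed
  have eq: "AE x in lebesgue_on Lam. ln (cmod (poly P (cis x))) = k x"
    using AE_poly_cis_nonzero[OF Suc.prems]
  proof eventually_elim
    case (elim x)
    note PP'[of "cis x"]
    also have "cmod (cis x - a) * cmod (poly P' (cis x)) = c * cmod (1 - b * cis x) * cmod (poly P' (cis x))"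
      by (subst bc(3)) auto
    finally have e: "cmod (poly P (cis x)) = c * (cmod (1 - b * cis x) * cmod (poly P' (cis x)))" by simp
    with elim have "cmod (1 - b * cis x) \<noteq> 0" "cmod (poly P' (cis x)) \<noteq> 0" by auto
    then have "0 < cmod (1 - b * cis x)" "0 < cmod (poly P' (cis x))" by simp_all
    then show ?case unfolding e k_def using bc(2) by (subst ln_mult; simp add: ln_mult)
  qed
  have m: "(\<lambda>x. ln (cmod (poly P (cis x)))) \<in> borel_measurable (lebesgue_on Lam)"
  proof -
    have "(\<lambda>x. cmod (poly P (cis x))) \<in> borel_measurable (lebesgue_on Lam)"
      by (intro continuous_imp_measurable_on_sets_lebesgue continuous_intros) simp
    then show ?thesis by measurable
  qed
  have "L1 (\<lambda>x. ln (cmod (poly P (cis x))))"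
    using L1k eq m unfolding L1_def by (subst integrable_cong_AE[where g = k]) auto
  moreover have "Lint (\<lambda>x. ln (cmod (poly P (cis x)))) = Lint k"
    using L1k eq m unfolding Lint_def L1_def by (intro integral_cong_AE) auto
  moreover have "poly R 0 \<noteq> 0" using R0 bc(2) R'(1) by auto
  ultimately show ?case using Lintk PR by (intro exI[of _ R]) auto
qed

section \<open>Prediction errors under polynomial weights\<close>

text \<open>The complex conjugate of \<open>1 - \<Sum>c k * exp (-ikx)\<close> is a polynomial in \<open>exp (ix)\<close> with
  constant coefficient 1.\<close>

lemma pred_err2_eq_Inf_poly:
  "pred_err2 n f = Inf {Lint (\<lambda>x. (cmod (poly p (cis x)))\<^sup>2 * f x) |p. degree p \<le> n \<and> poly p 0 = 1}"
proof -
  let ?c = "\<lambda>c x. cmod (1 - (\<Sum>k=1..n. c k * exp (- \<i> * of_nat k * of_real x)))"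
  have e: "exp (- \<i> * of_nat k * of_real x) = cnj (cis x ^ k)" for k x
    by (simp add: cis_conv_exp exp_cnj algebra_simps flip: exp_of_nat_mult)
  have A: "\<exists>p. degree p \<le> n \<and> poly p 0 = 1 \<and> (\<forall>x. ?c c x = cmod (poly p (cis x)))" for c
  proof (intro exI conjI allI)
    let ?p = "1 - (\<Sum>k=1..n. monom (cnj (c k)) k)"
    show "degree ?p \<le> n"
      by (intro degree_diff_le degree_sum_le) (auto intro: order_trans[OF degree_monom_le])
    show "poly ?p 0 = 1" by (simp add: poly_sum poly_monom)
    fix x
    have "1 - (\<Sum>k=1..n. c k * exp (- \<i> * of_nat k * of_real x)) = cnj (poly ?p (cis x))"
      unfolding e by (simp add: poly_sum poly_monom)
    then show "?c c x = cmod (poly ?p (cis x))" by (metis complex_mod_cnj)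
  qed
  have B: "\<exists>c. \<forall>x. ?c c x = cmod (poly p (cis x))" if p: "degree p \<le> n" "poly p 0 = 1" for p
  proof (intro exI allI)
    fix x
    have "poly p (cis x) = (\<Sum>k\<le>n. coeff p k * cis x ^ k)"
      unfolding poly_altdef using p(1) by (intro sum.mono_neutral_left) (auto simp: coeff_eq_0)
    also have "{..n} = insert 0 {1..n}" by auto
    also have "(\<Sum>k\<in>\<dots>. coeff p k * cis x ^ k) = 1 + (\<Sum>k=1..n. coeff p k * cis x ^ k)"
      using p(2) by (simp add: poly_0_coeff_0)
    finally have "cnj (poly p (cis x)) =
        1 - (\<Sum>k=1..n. - cnj (coeff p k) * exp (- \<i> * of_nat k * of_real x))"
      unfolding e by (simp add: sum_negf)
    then show "?c (\<lambda>k. - cnj (coeff p k)) x = cmod (poly p (cis x))" by (metis complex_mod_cnj)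
  qed
  have "{Lint (\<lambda>x. (?c c x)\<^sup>2 * f x) |c. True} =
      {Lint (\<lambda>x. (cmod (poly p (cis x)))\<^sup>2 * f x) |p. degree p \<le> n \<and> poly p 0 = 1}"
    (is "?L = ?R")
  proof
    show "?L \<subseteq> ?R"
    proof
      fix y assume "y \<in> ?L"
      then obtain c where y: "y = Lint (\<lambda>x. (?c c x)\<^sup>2 * f x)" by blast
      obtain p where "degree p \<le> n" "poly p 0 = 1" "\<forall>x. ?c c x = cmod (poly p (cis x))" using A by blast
      then show "y \<in> ?R" unfolding y by auto
    qed
    show "?R \<subseteq> ?L"
    proof
      fix y assume "y \<in> ?R"
      then obtain p where y: "y = Lint (\<lambda>x. (cmod (poly p (cis x)))\<^sup>2 * f x)"
        and "degree p \<le> n" "poly p 0 = 1" by blast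
      then obtain c where "\<forall>x. ?c c x = cmod (poly p (cis x))" using B by blast
      then have "y = Lint (\<lambda>x. (?c c x)\<^sup>2 * f x)" by (simp add: y)
      then show "y \<in> ?L" by blast
    qed
  qed
  then show ?thesis unfolding pred_err2_def by simp
qed

lemma pred_err2_le:
  assumes "\<And>x. x \<in> Lam \<Longrightarrow> 0 \<le> w x" "degree p \<le> n" "poly p 0 = 1"
  shows "pred_err2 n w \<le> Lint (\<lambda>x. (cmod (poly p (cis x)))\<^sup>2 * w x)"
  unfolding pred_err2_eq_Inf_poly
proof (rule cInf_lower)
  show "bdd_below {Lint (\<lambda>x. (cmod (poly p (cis x)))\<^sup>2 * w x) |p. degree p \<le> n \<and> poly p 0 = 1}"
    using assms(1) by (intro bdd_belowI[of _ 0]) (auto intro!: Lint_nonneg)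
qed (use assms in auto)

lemma pred_err2_greatest:
  assumes "\<And>p. degree p \<le> n \<Longrightarrow> poly p 0 = 1 \<Longrightarrow> c \<le> Lint (\<lambda>x. (cmod (poly p (cis x)))\<^sup>2 * w x)"
  shows "c \<le> pred_err2 n w"
  unfolding pred_err2_eq_Inf_poly
proof (rule cInf_greatest)
  have "degree (1::complex poly) \<le> n \<and> poly (1::complex poly) 0 = 1" by simp
  then show "{Lint (\<lambda>x. (cmod (poly p (cis x)))\<^sup>2 * w x) |p. degree p \<le> n \<and> poly p 0 = 1} \<noteq> {}"
    by blast
qed (use assms in auto)

lemma pred_err2_nonneg: "(\<And>x. x \<in> Lam \<Longrightarrow> 0 \<le> w x) \<Longrightarrow> 0 \<le> pred_err2 n w"
  by (intro pred_err2_greatest Lint_nonneg) auto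

lemma L1_cmod_poly_mult:
  assumes "L1 w"
  shows "L1 (\<lambda>x. (cmod (poly p (cis x)))\<^sup>2 * w x)"
proof -
  obtain m where m: "\<And>z. cmod z \<le> 1 \<Longrightarrow> cmod (poly p z) \<le> m" using poly_bound_exists by blast
  show ?thesis
  proof (rule L1_bounded_mult[OF _ _ assms])
    show "(\<lambda>x. (cmod (poly p (cis x)))\<^sup>2) \<in> borel_measurable (lebesgue_on Lam)"
      by (intro continuous_imp_measurable_on_sets_lebesgue continuous_intros) simp
    show "\<bar>(cmod (poly p (cis x)))\<^sup>2\<bar> \<le> m\<^sup>2" for x
      using m[of "cis x"] by (simp add: power_mono)
  qed
qed

text \<open>A competitor \<open>p\<close> for \<open>v\<close> becomes the competitor
  \<open>p * q / q(0)\<close> for \<open>w\<close>, of degree at most \<open>n + \<nu>\<close>.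
  Asking for the bound only almost everywhere lets the zeros of \<open>t\<close> be ignored
  later.\<close>

lemma pred_err2_poly_weight:
  assumes w: "\<And>x. x \<in> Lam \<Longrightarrow> 0 \<le> w x" "L1 w" and v: "L1 v"
    and le: "AE x in lebesgue_on Lam. (cmod (poly q (cis x)))\<^sup>2 * w x \<le> v x"
    and q: "degree q \<le> \<nu>" "poly q 0 \<noteq> 0"
  shows "(cmod (poly q 0))\<^sup>2 * pred_err2 (n + \<nu>) w \<le> pred_err2 n v"
proof (rule pred_err2_greatest)
  fix p :: "complex poly" assume p: "degree p \<le> n" "poly p 0 = 1"
  define p' where "p' = smult (1 / poly q 0) (p * q)"
  have p': "(cmod (poly p' z))\<^sup>2 = (cmod (poly p z))\<^sup>2 * (cmod (poly q z))\<^sup>2 / (cmod (poly q 0))\<^sup>2" for z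
    by (simp add: p'_def norm_mult norm_divide power_mult_distrib power_divide)
  have "degree p' \<le> n + \<nu>"
    using degree_mult_le[of p q] p(1) q(1) by (simp add: p'_def)
  moreover have "poly p' 0 = 1" using p q by (simp add: p'_def)
  ultimately have "pred_err2 (n + \<nu>) w \<le> Lint (\<lambda>x. (cmod (poly p' (cis x)))\<^sup>2 * w x)"
    using w(1) by (intro pred_err2_le) auto
  also have "\<dots> \<le> Lint (\<lambda>x. (cmod (poly p (cis x)))\<^sup>2 * v x / (cmod (poly q 0))\<^sup>2)"
  proof (rule Lint_mono_AE)
    show "L1 (\<lambda>x. (cmod (poly p' (cis x)))\<^sup>2 * w x)" by (rule L1_cmod_poly_mult[OF w(2)])
    show "L1 (\<lambda>x. (cmod (poly p (cis x)))\<^sup>2 * v x / (cmod (poly q 0))\<^sup>2)"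
      using L1_cmod_poly_mult[OF v] by (simp add: L1_def)
    show "AE x in lebesgue_on Lam. (cmod (poly p' (cis x)))\<^sup>2 * w x
        \<le> (cmod (poly p (cis x)))\<^sup>2 * v x / (cmod (poly q 0))\<^sup>2"
      using le
    proof eventually_elim
      case (elim x)
      then have "(cmod (poly p (cis x)))\<^sup>2 * ((cmod (poly q (cis x)))\<^sup>2 * w x) / (cmod (poly q 0))\<^sup>2
          \<le> (cmod (poly p (cis x)))\<^sup>2 * v x / (cmod (poly q 0))\<^sup>2"
        by (intro divide_right_mono mult_left_mono) auto
      then show ?case by (simp add: p' mult.assoc)
    qed
  qed
  also have "\<dots> = Lint (\<lambda>x. (cmod (poly p (cis x)))\<^sup>2 * v x) / (cmod (poly q 0))\<^sup>2"
    by (simp add: Lint_def)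
  finally show "(cmod (poly q 0))\<^sup>2 * pred_err2 (n + \<nu>) w \<le> Lint (\<lambda>x. (cmod (poly p (cis x)))\<^sup>2 * v x)"
    using q(2) by (simp add: field_simps)
qed

section \<open>Monotonicity and limits of error ratios\<close>

lemma pred_err2_antimono:
  assumes "\<And>x. x \<in> Lam \<Longrightarrow> 0 \<le> w x" "L1 w"
  shows "pred_err2 (n + m) w \<le> pred_err2 n w"
  using pred_err2_poly_weight[OF assms assms(2), of 1 m n] by simp

text \<open>If one error vanished, all later ones would too, and with \<open>0 / 0 = 0\<close> the
  ratios would tend to 0 instead of 1.\<close>

lemma classF_pred_err2_pos:
  assumes "classF f"
  shows "0 < pred_err2 n f"
proof (rule ccontr)
  assume n: "\<not> 0 < pred_err2 n f"
  have f: "\<And>x. x \<in> Lam \<Longrightarrow> 0 \<le> f x" "L1 f" using assms by (auto simp: classF_def)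
  have "pred_err2 (n + m) f = 0" for m
    using pred_err2_antimono[OF f, of n m] pred_err2_nonneg[of f "n + m"] f(1) n by simp
  then have "\<forall>\<^sub>F m in sequentially. pred_err (Suc m) f / pred_err m f = 0"
    by (auto simp: eventually_sequentially pred_err_def le_iff_add intro!: exI[of _ n])
  then have "(\<lambda>m. pred_err (Suc m) f / pred_err m f) \<longlonglongrightarrow> 0"
    by (rule tendsto_eventually)
  then show False using assms LIMSEQ_unique by (fastforce simp: classF_def)
qed

text \<open>The quotient telescopes into \<open>m\<close> one-step ratios, each the square of a
  ratio tending to 1; positivity of the errors allows the cancellation.\<close>

lemma classF_pred_err2_ratio:
  assumes "classF f"
  shows "(\<lambda>n. pred_err2 (n + m) f / pred_err2 n f) \<longlonglongrightarrow> 1"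
proof (induction m)
  case 0
  have "pred_err2 n f \<noteq> 0" for n using classF_pred_err2_pos[OF assms, of n] by simp
  then show ?case by simp
next
  case (Suc m)
  have "(\<lambda>n. pred_err (Suc n) f / pred_err n f) \<longlonglongrightarrow> 1" using assms by (simp add: classF_def)
  then have "(\<lambda>n. (pred_err (Suc n) f / pred_err n f)\<^sup>2) \<longlonglongrightarrow> 1\<^sup>2" by (intro tendsto_intros)
  moreover have "(pred_err (Suc n) f / pred_err n f)\<^sup>2 = pred_err2 (Suc n) f / pred_err2 n f" for n
    using classF_pred_err2_pos[OF assms] by (simp add: pred_err_def power_divide less_imp_le)
  ultimately have "(\<lambda>n. pred_err2 (Suc n) f / pred_err2 n f) \<longlonglongrightarrow> 1" by simp
  from LIMSEQ_ignore_initial_segment[OF this, of m]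
  have "(\<lambda>n. pred_err2 (Suc (n + m)) f / pred_err2 (n + m) f) \<longlonglongrightarrow> 1" .
  from tendsto_mult[OF this Suc.IH]
  have "(\<lambda>n. pred_err2 (Suc (n + m)) f / pred_err2 (n + m) f * (pred_err2 (n + m) f / pred_err2 n f)) \<longlonglongrightarrow> 1"
    by simp
  moreover have "pred_err2 (n + m) f \<noteq> 0" for n using classF_pred_err2_pos[OF assms, of "n + m"] by simp
  ultimately show ?case by simp
qed

text \<open>In the application \<open>c\<close> is the logarithm of the geometric mean. The
  polynomials \<open>s\<close> bound the ratio from below and the \<open>r\<close> from above, each
  up to the factor \<open>exp (- \<delta>)\<close> or its inverse; the degree shifts disappear in
  the limit.\<close>

lemma pred_err2_ratio_tendsto:
  assumes f: "classF f" and v: "L1 v" "\<And>x. x \<in> Lam \<Longrightarrow> 0 \<le> v x"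
    and lower: "\<And>\<delta>. 0 < \<delta> \<Longrightarrow> \<exists>s. (AE x in lebesgue_on Lam. (cmod (poly s (cis x)))\<^sup>2 * f x \<le> v x) \<and>
        exp (c - \<delta>) \<le> (cmod (poly s 0))\<^sup>2"
    and upper: "\<And>\<delta>. 0 < \<delta> \<Longrightarrow> \<exists>r. (AE x in lebesgue_on Lam. (cmod (poly r (cis x)))\<^sup>2 * v x \<le> f x) \<and>
        exp (- c - \<delta>) \<le> (cmod (poly r 0))\<^sup>2"
  shows "(\<lambda>n. pred_err2 n v / pred_err2 n f) \<longlonglongrightarrow> exp c"
proof (rule order_tendstoI)
  have f': "\<And>x. x \<in> Lam \<Longrightarrow> 0 \<le> f x" "L1 f" using f by (auto simp: classF_def)
  note pos = classF_pred_err2_pos[OF f]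
  have ex: "\<exists>\<delta>>0. exp a < exp (b - \<delta>)" if "a < b" for a b :: real
    using that by (intro exI[of _ "(b - a) / 2"]) (auto simp: field_simps)
  {
    fix y assume y: "y < exp c"
    obtain \<delta> where \<delta>: "0 < \<delta>" "y < exp (c - \<delta>)"
    proof (cases "0 < y")
      case True
      then have "ln y < c" using y by (metis exp_ln exp_less_cancel_iff)
      then obtain \<delta> where "0 < \<delta>" "exp (ln y) < exp (c - \<delta>)" using ex by blast
      then show ?thesis using that True by simp
    next
      case False
      then show ?thesis using that[of 1] by (meson exp_gt_zero le_less_trans not_less zero_less_one)
    qed
    from lower[OF \<delta>(1)] obtain s where s: "AE x in lebesgue_on Lam. (cmod (poly s (cis x)))\<^sup>2 * f x \<le> v x"
      "exp (c - \<delta>) \<le> (cmod (poly s 0))\<^sup>2" by blast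
    then have s0: "poly s 0 \<noteq> 0" by auto
    have "(\<lambda>n. (cmod (poly s 0))\<^sup>2 * (pred_err2 (n + degree s) f / pred_err2 n f)) \<longlonglongrightarrow> (cmod (poly s 0))\<^sup>2 * 1"
      by (intro tendsto_intros classF_pred_err2_ratio f)
    then have "\<forall>\<^sub>F n in sequentially. y < (cmod (poly s 0))\<^sup>2 * (pred_err2 (n + degree s) f / pred_err2 n f)"
      using s(2) \<delta>(2) by (elim order_tendstoD) simp
    then show "\<forall>\<^sub>F n in sequentially. y < pred_err2 n v / pred_err2 n f"
    proof eventually_elim
      case (elim n)
      have "(cmod (poly s 0))\<^sup>2 * pred_err2 (n + degree s) f / pred_err2 n f \<le> pred_err2 n v / pred_err2 n f"
        using pos[of n] pred_err2_poly_weight[OF f' v(1) s(1) order_refl s0]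
        by (intro divide_right_mono) auto
      then show ?case using elim by simp
    qed
  }
  {
    fix y assume y: "exp c < y"
    then have "0 < y" using exp_gt_zero less_trans by blast
    then have "c < ln y" using y by (metis exp_ln exp_less_cancel_iff)
    then obtain \<delta> where \<delta>: "0 < \<delta>" "exp (- ln y) < exp (- c - \<delta>)" using ex[of "- ln y" "- c"] by auto
    from upper[OF \<delta>(1)] obtain r where r: "AE x in lebesgue_on Lam. (cmod (poly r (cis x)))\<^sup>2 * v x \<le> f x"
      "exp (- c - \<delta>) \<le> (cmod (poly r 0))\<^sup>2" by blast
    then have r0: "poly r 0 \<noteq> 0" by auto
    have "(\<lambda>n. (cmod (poly r 0))\<^sup>2 * (pred_err2 (n + degree r) f / pred_err2 n f)) \<longlonglongrightarrow> (cmod (poly r 0))\<^sup>2 * 1"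
      by (intro tendsto_intros classF_pred_err2_ratio f)
    moreover have "exp (- ln y) < (cmod (poly r 0))\<^sup>2" using r(2) \<delta>(2) by linarith
    ultimately have "\<forall>\<^sub>F n in sequentially. exp (- ln y) < (cmod (poly r 0))\<^sup>2 * (pred_err2 (n + degree r) f / pred_err2 n f)"
      by (elim order_tendstoD) simp
    \<comment> \<open>The bound from \<open>r\<close> concerns the error of \<open>v\<close> at the
      shifted index, so the ratio is controlled there first and the index is shifted back
      afterwards.\<close>
    then have "\<forall>\<^sub>F n in sequentially. pred_err2 (n + degree r) v / pred_err2 (n + degree r) f < y"
    proof eventually_elim
      case (elim n)
      have "(cmod (poly r 0))\<^sup>2 * pred_err2 (n + degree r) v \<le> pred_err2 n f"
        by (rule pred_err2_poly_weight[OF v(2) v(1) f'(2) r(1) order_refl r0])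
      moreover have "pred_err2 n f < y * ((cmod (poly r 0))\<^sup>2 * pred_err2 (n + degree r) f)"
        using elim pos[of n] \<open>0 < y\<close> by (simp add: exp_minus field_simps)
      ultimately have "(cmod (poly r 0))\<^sup>2 * pred_err2 (n + degree r) v <
          (cmod (poly r 0))\<^sup>2 * (y * pred_err2 (n + degree r) f)" by (simp add: algebra_simps)
      then have "pred_err2 (n + degree r) v < y * pred_err2 (n + degree r) f"
        using r0 by (simp add: mult_less_cancel_left_pos)
      then show ?case using pos[of "n + degree r"] by (simp add: field_simps)
    qed
    then show "\<forall>\<^sub>F n in sequentially. pred_err2 n v / pred_err2 n f < y"
      by (simp add: eventually_sequentially_seg[where P = "\<lambda>n. pred_err2 n v / pred_err2 n f < y"])
  }
qed

section \<open>Weights with regularised zeros\<close>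

text \<open>Multiplication by \<open>cis x ^ \<nu>\<close> removes the negative frequencies without
  changing the modulus, and a nonnegative \<open>t\<close> is its own modulus.\<close>

lemma trig_poly_eq_cmod_poly:
  assumes "trig_poly t" "\<forall>x. 0 \<le> t x"
  shows "\<exists>P. \<forall>x. t x = cmod (poly P (cis x))"
proof -
  obtain \<nu> c where t: "\<And>x. complex_of_real (t x) = (\<Sum>k\<in>{-int \<nu>..int \<nu>}. c k * exp (\<i> * of_int k * of_real x))"
    using assms(1) unfolding trig_poly_def by metis
  define P where "P = (\<Sum>k\<in>{-int \<nu>..int \<nu>}. monom (c k) (nat (k + int \<nu>)))"
  have "t x = cmod (poly P (cis x))" for x
  proof -
    have "poly P (cis x) = (\<Sum>k\<in>{-int \<nu>..int \<nu>}. c k * exp (\<i> * of_int k * of_real x) * cis x ^ \<nu>)"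
      unfolding P_def poly_sum poly_monom
    proof (rule sum.cong)
      fix k assume k: "k \<in> {-int \<nu>..int \<nu>}"
      have "exp (\<i> * of_int k * of_real x) = cis (of_int k * x)"
        by (simp add: cis_conv_exp algebra_simps)
      moreover have "real (nat (k + int \<nu>)) = of_int k + real \<nu>" using k by simp
      ultimately show "c k * cis x ^ nat (k + int \<nu>) = c k * exp (\<i> * of_int k * of_real x) * cis x ^ \<nu>"
        by (simp add: Complex.DeMoivre cis_mult algebra_simps)
    qed simp
    also have "\<dots> = of_real (t x) * cis x ^ \<nu>" by (simp only: t sum_distrib_right)
    finally show ?thesis using assms(2) by (simp add: norm_mult norm_power)
  qed
  then show ?thesis by blast
qed

text \<open>Dominated convergence: for \<open>\<epsilon> \<le> 1\<close> the regularised logarithm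
  lies between \<open>ln (t x)\<close> and \<open>ln (T + 1)\<close>.\<close>

lemma Lint_ln_add_eps_approx:
  assumes t: "continuous_on UNIV t" "\<And>x. 0 \<le> t x" "\<And>x. t x \<le> T" "AE x in lebesgue_on Lam. 0 < t x"
    and L: "L1 (\<lambda>x. ln (t x))" and \<eta>: "0 < \<eta>"
  shows "\<exists>\<epsilon>>0. Lint (\<lambda>x. ln (t x + \<epsilon>)) < Lint (\<lambda>x. ln (t x)) + \<eta>"
proof -
  have T: "0 \<le> T" using t(2)[of 0] t(3)[of 0] by simp
  define \<epsilon> where "\<epsilon> n = inverse (real (Suc n))" for n
  have \<epsilon>: "0 < \<epsilon> n" "\<epsilon> n \<le> 1" for n by (auto simp: \<epsilon>_def inverse_le_1_iff)
  have lim: "\<epsilon> \<longlonglongrightarrow> 0" unfolding \<epsilon>_def by (rule LIMSEQ_inverse_real_of_nat)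
  have "(\<lambda>n. Lint (\<lambda>x. ln (t x + \<epsilon> n))) \<longlonglongrightarrow> Lint (\<lambda>x. ln (t x))"
    unfolding Lint_def
  proof (rule integral_dominated_convergence[where w = "\<lambda>x. \<bar>ln (t x)\<bar> + ln (T + 1)"])
    show "(\<lambda>x. ln (t x)) \<in> borel_measurable (lebesgue_on Lam)" using L by (auto simp: L1_def)
    have tm: "t \<in> borel_measurable (lebesgue_on Lam)"
      by (intro continuous_imp_measurable_on_sets_lebesgue continuous_on_subset[OF t(1)]) auto
    show "(\<lambda>x. ln (t x + \<epsilon> n)) \<in> borel_measurable (lebesgue_on Lam)" for n
      using tm by measurable
    show "integrable (lebesgue_on Lam) (\<lambda>x. \<bar>ln (t x)\<bar> + ln (T + 1))"
      using L L1_const[of "ln (T + 1)"] by (simp add: L1_def)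
    show "AE x in lebesgue_on Lam. (\<lambda>n. ln (t x + \<epsilon> n)) \<longlonglongrightarrow> ln (t x)"
      using t(4)
    proof eventually_elim
      case (elim x)
      have "(\<lambda>n. ln (t x + \<epsilon> n)) \<longlonglongrightarrow> ln (t x + 0)"
        using elim by (intro tendsto_intros lim) auto
      then show ?case by simp
    qed
    show "AE x in lebesgue_on Lam. norm (ln (t x + \<epsilon> n)) \<le> \<bar>ln (t x)\<bar> + ln (T + 1)" for n
      using t(4)
    proof eventually_elim
      case (elim x)
      have "ln (t x) \<le> ln (t x + \<epsilon> n)" "ln (t x + \<epsilon> n) \<le> ln (T + 1)"
        using elim \<epsilon>[of n] t(3)[of x] by (auto intro!: ln_mono add_mono)
      moreover have "0 \<le> ln (T + 1)" using T by simp
      ultimately show ?case by (auto simp: abs_le_iff)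
    qed
  qed
  then have "\<forall>\<^sub>F n in sequentially. Lint (\<lambda>x. ln (t x + \<epsilon> n)) < Lint (\<lambda>x. ln (t x)) + \<eta>"
    using \<eta> by (elim order_tendstoD) simp
  then obtain n where "Lint (\<lambda>x. ln (t x + \<epsilon> n)) < Lint (\<lambda>x. ln (t x)) + \<eta>"
    by (auto simp: eventually_sequentially)
  then show ?thesis using \<epsilon>(1) by blast
qed

text \<open>Used with \<open>v = ln h\<close>, \<open>\<gamma> = \<alpha>\<close> for the lower
  bound and with \<open>v = - ln h\<close>, \<open>\<gamma> = 2 * K - \<alpha>\<close> for the upper
  one. Adding \<open>\<epsilon>\<close> keeps the exponent bounded near the zeros of
  \<open>t\<close>.\<close>

lemma poly_approx_regularised_weight:
  assumes t: "continuous_on UNIV t" "\<And>x. 0 \<le> t x" "\<And>x. t x \<le> T" "AE x in lebesgue_on Lam. 0 < t x"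
    and L: "L1 (\<lambda>x. ln (t x))"
    and v: "\<And>x. x \<in> Lam \<Longrightarrow> \<bar>v x\<bar> \<le> B" "AE x in lebesgue_on Lam. isCont v x"
    and \<gamma>: "0 \<le> \<gamma>" and \<delta>: "0 < \<delta>"
  shows "\<exists>\<epsilon>>0. \<exists>q. (\<forall>x\<in>Lam. (cmod (poly q (cis x)))\<^sup>2 \<le> exp (v x) * (t x + \<epsilon>) powr (- \<gamma>)) \<and>
     exp ((Lint v - \<gamma> * Lint (\<lambda>x. ln (t x))) / (2 * pi) - \<delta>) \<le> (cmod (poly q 0))\<^sup>2"
proof -
  \<comment> \<open>Passing from \<open>t\<close> to \<open>t + \<epsilon>\<close> then costs at
    most \<open>\<gamma> * \<eta> \<le> pi * \<delta>\<close> in the integral, which is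
    \<open>\<delta> / 2\<close> in the mean; the other half goes to the polynomial. The added 1
    covers \<open>\<gamma> = 0\<close>.\<close>
  define \<eta> where "\<eta> = pi * \<delta> / (\<gamma> + 1)"
  have \<eta>: "0 < \<eta>" using \<gamma> \<delta> by (simp add: \<eta>_def)
  obtain \<epsilon> where \<epsilon>: "0 < \<epsilon>" "Lint (\<lambda>x. ln (t x + \<epsilon>)) < Lint (\<lambda>x. ln (t x)) + \<eta>"
    using Lint_ln_add_eps_approx[OF t L \<eta>] by blast
  define u where "u x = v x - \<gamma> * ln (t x + \<epsilon>)" for x
  have tb: "\<bar>ln (t x + \<epsilon>)\<bar> \<le> \<bar>ln \<epsilon>\<bar> + \<bar>ln (T + \<epsilon>)\<bar>" for x
  proof -
    have "ln \<epsilon> \<le> ln (t x + \<epsilon>)" "ln (t x + \<epsilon>) \<le> ln (T + \<epsilon>)"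
      using \<epsilon> t(2,3)[of x] by (auto intro!: ln_mono add_pos_nonneg add_nonneg_pos)
    then show ?thesis by linarith
  qed
  have tc: "continuous_on UNIV (\<lambda>x. ln (t x + \<epsilon>))"
    using t(1,2) \<epsilon>(1) by (intro continuous_intros) (auto simp: add_nonneg_eq_0_iff)
  have "\<exists>q. (\<forall>x\<in>Lam. (cmod (poly q (cis x)))\<^sup>2 \<le> exp (u x)) \<and>
      exp (Lint u / (2 * pi) - \<delta> / 2) \<le> (cmod (poly q 0))\<^sup>2"
  proof (rule poly_approx_exp_from_below)
    show "\<bar>u x\<bar> \<le> B + \<gamma> * (\<bar>ln \<epsilon>\<bar> + \<bar>ln (T + \<epsilon>)\<bar>)" if "x \<in> Lam" for x
    proof -
      have "\<bar>u x\<bar> \<le> \<bar>v x\<bar> + \<gamma> * \<bar>ln (t x + \<epsilon>)\<bar>"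
        unfolding u_def using \<gamma> by (metis abs_mult abs_of_nonneg abs_triangle_ineq4)
      also have "\<dots> \<le> B + \<gamma> * (\<bar>ln \<epsilon>\<bar> + \<bar>ln (T + \<epsilon>)\<bar>)"
        using v(1)[OF that] tb \<gamma> by (intro add_mono mult_left_mono)
      finally show ?thesis .
    qed
    show "AE x in lebesgue_on Lam. isCont u x"
      using v(2)
    proof eventually_elim
      case (elim x)
      have "isCont (\<lambda>x. ln (t x + \<epsilon>)) x" using tc by (simp add: continuous_on_eq_continuous_at)
      then show ?case unfolding u_def using elim by (intro continuous_diff continuous_mult continuous_const)
    qed
    show "0 < \<delta> / 2" using \<delta> by simp
  qed
  then obtain q where q: "\<And>x. x \<in> Lam \<Longrightarrow> (cmod (poly q (cis x)))\<^sup>2 \<le> exp (u x)"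
    "exp (Lint u / (2 * pi) - \<delta> / 2) \<le> (cmod (poly q 0))\<^sup>2" by blast
  have expu: "exp (u x) = exp (v x) * (t x + \<epsilon>) powr (- \<gamma>)" for x
    using t(2)[of x] \<epsilon>(1) by (simp add: u_def powr_def exp_diff exp_minus divide_inverse)
  have "L1 v"
    by (rule L1_bounded[OF AE_isCont_imp_borel_measurable[OF _ v(2)] AE_Lam_I[OF v(1)]]) auto
  moreover have "L1 (\<lambda>x. ln (t x + \<epsilon>))"
    by (intro L1_continuous continuous_on_subset[OF tc]) auto
  ultimately have "Lint u = Lint v - \<gamma> * Lint (\<lambda>x. ln (t x + \<epsilon>))"
    unfolding u_def by (subst Lint_diff) (auto simp: Lint_cmult L1_cmult)
  moreover have "\<gamma> * Lint (\<lambda>x. ln (t x + \<epsilon>)) \<le> \<gamma> * (Lint (\<lambda>x. ln (t x)) + \<eta>)"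
    using \<epsilon>(2) \<gamma> by (intro mult_left_mono) auto
  moreover have "\<gamma> * \<eta> \<le> pi * \<delta>"
    using \<gamma> \<delta> by (simp add: \<eta>_def field_simps)
  ultimately have "Lint v - \<gamma> * Lint (\<lambda>x. ln (t x)) - pi * \<delta> \<le> Lint u"
    by (simp add: algebra_simps)
  then have "(Lint v - \<gamma> * Lint (\<lambda>x. ln (t x)) - pi * \<delta>) / (2 * pi) \<le> Lint u / (2 * pi)"
    by (intro divide_right_mono) auto
  then have "exp ((Lint v - \<gamma> * Lint (\<lambda>x. ln (t x))) / (2 * pi) - \<delta>) \<le> exp (Lint u / (2 * pi) - \<delta> / 2)"
    by (simp add: field_simps)
  then have "exp ((Lint v - \<gamma> * Lint (\<lambda>x. ln (t x))) / (2 * pi) - \<delta>) \<le> (cmod (poly q 0))\<^sup>2"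
    using q(2) by (rule order_trans)
  then show ?thesis using \<epsilon>(1) q(1) unfolding expu by blast
qed

text \<open>If the product had positive geometric mean, \<open>ln f = ln (f * g) - ln g\<close>
  would be integrable. The ratio condition passes from \<open>f\<close> to the product because their
  errors are asymptotically proportional with positive factor \<open>geom_mean g\<close>.\<close>

lemma classF_mult_classM:
  assumes f: "classF f" and g: "classM f g"
  shows "classF (\<lambda>x. f x * g x)"
proof -
  define v where "v = (\<lambda>x. f x * g x)"
  have f': "\<And>x. x \<in> Lam \<Longrightarrow> 0 \<le> f x" "L1 f" using f by (auto simp: classF_def)
  have gpos: "AE x in lebesgue_on Lam. 0 < g x" and Lg: "L1 (\<lambda>x. ln (g x))" and G: "0 < geom_mean g"
    using g by (auto simp: classM_def geom_mean_def split: if_splits)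
  have v: "L1 v" and lim: "(\<lambda>n. pred_err2 n v / pred_err2 n f) \<longlonglongrightarrow> geom_mean g"
    using g by (auto simp: classM_def v_def)
  have "geom_mean v = 0"
  proof (rule ccontr)
    assume "geom_mean v \<noteq> 0"
    then have vpos: "AE x in lebesgue_on Lam. 0 < v x" and Lv: "L1 (\<lambda>x. ln (v x))"
      by (auto simp: geom_mean_def split: if_splits)
    have fpos: "AE x in lebesgue_on Lam. 0 < f x"
      using vpos gpos by eventually_elim (auto simp: v_def zero_less_mult_iff)
    have eq: "AE x in lebesgue_on Lam. ln (f x) = ln (v x) - ln (g x)"
      using fpos gpos by eventually_elim (simp add: v_def ln_mult)
    have "f \<in> borel_measurable (lebesgue_on Lam)" using f'(2) by (auto simp: L1_def)
    then have "(\<lambda>x. ln (f x)) \<in> borel_measurable (lebesgue_on Lam)" by measurable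
    then have "L1 (\<lambda>x. ln (f x))" by (rule L1_cong_AE(1)[OF L1_diff[OF Lv Lg] _ eq])
    then have "geom_mean f \<noteq> 0" using fpos by (simp add: geom_mean_def)
    then show False using f by (simp add: classF_def)
  qed
  moreover have "(\<lambda>n. pred_err (Suc n) v / pred_err n v) \<longlonglongrightarrow> 1"
  proof -
    have ne: "pred_err2 n f \<noteq> 0" for n using classF_pred_err2_pos[OF f, of n] by simp
    \<comment> \<open>The errors of \<open>f\<close> are inserted so that the numerator and the
      denominator have the same positive limit.\<close>
    have "(\<lambda>n. sqrt (pred_err2 (Suc n) v / pred_err2 (Suc n) f * (pred_err2 (n + 1) f / pred_err2 n f) /
        (pred_err2 n v / pred_err2 n f))) \<longlonglongrightarrow> sqrt (geom_mean g * 1 / geom_mean g)"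
      using G by (intro tendsto_intros lim classF_pred_err2_ratio f LIMSEQ_Suc[OF lim]) auto
    moreover have "pred_err2 (Suc n) v / pred_err2 (Suc n) f * (pred_err2 (n + 1) f / pred_err2 n f) /
        (pred_err2 n v / pred_err2 n f) = pred_err2 (Suc n) v / pred_err2 n v" for n
      using ne[of n] ne[of "Suc n"] by simp
    ultimately have "(\<lambda>n. sqrt (pred_err2 (Suc n) v / pred_err2 n v)) \<longlonglongrightarrow> sqrt (geom_mean g * 1 / geom_mean g)"
      by (simp only:)
    then show ?thesis using G by (simp add: pred_err_def real_sqrt_divide)
  qed
  moreover have "\<forall>x\<in>Lam. 0 \<le> v x" using f' g by (auto simp: v_def classM_def)
  ultimately show ?thesis using v by (simp add: classF_def v_def)
qed

section \<open>Weights with factor \<open>t powr (- \<alpha>)\<close>\<close>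

theorem mainTheorem13:
  fixes f h t :: "real \<Rightarrow> real" and \<alpha> :: real
  assumes "classF f"
    and "\<alpha> > 0"
    and "classBpm h"
    and "trig_poly t" and "\<forall>x. t x \<ge> 0" and "\<exists>x. t x \<noteq> 0"
    and "(\<alpha> \<in> \<int> \<and> L1 (\<lambda>x. f x * t x powr (- \<alpha>))) \<or>
         (\<alpha> \<notin> \<int> \<and> L1 (\<lambda>x. f x * t x powr (- (of_int \<lfloor>\<alpha>\<rfloor> + 1))))"
  shows "classM f (\<lambda>x. h x * t x powr (- \<alpha>)) \<and> classF (\<lambda>x. f x * (h x * t x powr (- \<alpha>)))"
proof -
  have f: "\<And>x. x \<in> Lam \<Longrightarrow> 0 \<le> f x" "L1 f" using assms(1) by (auto simp: classF_def)
  obtain P where P: "\<And>x. t x = cmod (poly P (cis x))"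
    using trig_poly_eq_cmod_poly[OF assms(4,5)] by blast
  have P0: "P \<noteq> 0" using assms(6) P by auto
  obtain R where R: "poly R 0 \<noteq> 0" "\<And>z. cmod z = 1 \<Longrightarrow> cmod (poly P z) = cmod (poly R z)"
    "L1 (\<lambda>x. ln (t x))" "Lint (\<lambda>x. ln (t x)) \<le> 2 * pi * ln (cmod (poly R 0))"
    unfolding P using outer_poly_exists[OF P0] by blast
  obtain T where T: "\<And>x. t x \<le> T"
    using poly_bound_exists[of 1 P] unfolding P by (metis norm_cis order_refl)
  have t0: "0 \<le> t x" for x using assms(5) by blast
  have tpos: "AE x in lebesgue_on Lam. 0 < t x"
    using AE_poly_cis_nonzero[OF P0] by eventually_elim (simp add: P)
  have tc: "continuous_on UNIV t" unfolding P by (intro continuous_intros)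
  have tm [measurable]: "t \<in> borel_measurable (lebesgue_on Lam)"
    by (intro continuous_imp_measurable_on_sets_lebesgue continuous_on_subset[OF tc]) auto
  obtain m M where mM: "0 < m" "\<And>x. x \<in> Lam \<Longrightarrow> m \<le> h x \<and> h x \<le> M"
    and hri: "riemann_integrable_on h (- pi) pi"
    using assms(3) by (auto simp: classBpm_def classB_def)
  have hcont: "AE x in lebesgue_on Lam. isCont h x"
    unfolding Lam_def by (rule riemann_integrable_AE_isCont[OF hri]) simp
  have hm [measurable]: "h \<in> borel_measurable (lebesgue_on Lam)"
    by (rule AE_isCont_imp_borel_measurable[OF _ hcont]) simp
  have hpos: "0 < h x" if "x \<in> Lam" for x using mM(2)[OF that] mM(1) by linarith
  have hposAE: "AE x in lebesgue_on Lam. 0 < h x" by (rule AE_Lam_I) (rule hpos)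
  define B where "B = \<bar>ln m\<bar> + \<bar>ln M\<bar>"
  have lnh: "\<bar>ln (h x)\<bar> \<le> B" if "x \<in> Lam" for x
  proof -
    have "ln m \<le> ln (h x)" "ln (h x) \<le> ln M"
      using mM(2)[OF that] mM(1) hpos[OF that] by (auto intro!: ln_mono)
    then show ?thesis unfolding B_def by linarith
  qed
  have lnhc: "AE x in lebesgue_on Lam. isCont (\<lambda>x. ln (h x)) x"
    using hcont AE_Lam_interior
  proof eventually_elim
    case (elim x)
    then have "h x \<noteq> 0" using hpos[of x] by (force simp: Lam_def)
    then show ?case using elim by (intro continuous_intros)
  qed
  have Lh: "L1 (\<lambda>x. ln (h x))"
    using lnh by (intro L1_bounded[of _ B] AE_Lam_I) auto
  define g where "g = (\<lambda>x. h x * t x powr (- \<alpha>))"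
  define v where "v = (\<lambda>x. f x * g x)"
  define c where "c = (Lint (\<lambda>x. ln (h x)) - \<alpha> * Lint (\<lambda>x. ln (t x))) / (2 * pi)"
  have Lft: "L1 (\<lambda>x. f x * t x powr (- \<alpha>))"
  proof (cases "\<alpha> \<in> \<int>")
    case True
    then show ?thesis using assms(7) by simp
  next
    case False
    \<comment> \<open>As \<open>\<beta>\<close> is nonnegative, \<open>t powr \<beta>\<close> is
      bounded, and multiplying the integrable function of case (b) by it gives the desired
      one.\<close>
    define \<beta> where "\<beta> = of_int \<lfloor>\<alpha>\<rfloor> + 1 - \<alpha>"
    have \<beta>: "0 \<le> \<beta>" unfolding \<beta>_def by linarith
    have "L1 (\<lambda>x. t x powr \<beta> * (f x * t x powr (- (of_int \<lfloor>\<alpha>\<rfloor> + 1))))"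
    proof (rule L1_bounded_mult)
      show "\<bar>t x powr \<beta>\<bar> \<le> T powr \<beta>" for x using T[of x] t0[of x] \<beta> by (simp add: powr_mono2)
    qed (use False assms(7) in auto)
    \<comment> \<open>Also true at zeros of \<open>t\<close>, where both sides vanish by the
      convention \<open>0 powr y = 0\<close>.\<close>
    moreover have "t x powr \<beta> * (f x * t x powr (- (of_int \<lfloor>\<alpha>\<rfloor> + 1))) = f x * t x powr (- \<alpha>)" for x
    proof -
      have "t x powr \<beta> * t x powr (- (of_int \<lfloor>\<alpha>\<rfloor> + 1)) = t x powr (- \<alpha>)"
        by (simp add: \<beta>_def flip: powr_add)
      then show ?thesis by (metis mult.left_commute)
    qed
    ultimately show ?thesis by (simp only:)
  qed
  have Lv: "L1 v"
  proof -
    have "L1 (\<lambda>x. h x * (f x * t x powr (- \<alpha>)))"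
      by (rule L1_bounded_mult[of _ M]) (use mM hpos Lft hm in \<open>fastforce+\<close>)
    then show ?thesis unfolding v_def g_def by (simp add: mult.left_commute)
  qed
  have v0: "0 \<le> v x" if "x \<in> Lam" for x
    using f(1)[OF that] hpos[OF that] by (simp add: v_def g_def)
  have gpos: "AE x in lebesgue_on Lam. 0 < g x"
    using tpos hposAE by eventually_elim (simp add: g_def)
  have lng: "AE x in lebesgue_on Lam. ln (g x) = ln (h x) - \<alpha> * ln (t x)"
    using tpos hposAE
    by eventually_elim (simp add: g_def ln_mult ln_powr)
  have lngm: "(\<lambda>x. ln (g x)) \<in> borel_measurable (lebesgue_on Lam)"
    unfolding g_def by measurable
  have "L1 (\<lambda>x. ln (g x))" "Lint (\<lambda>x. ln (g x)) = 2 * pi * c"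
    using L1_cong_AE[OF L1_diff[OF Lh L1_cmult[OF R(3)]] lngm lng] Lint_diff[OF Lh L1_cmult[OF R(3)]]
    by (auto simp: c_def Lint_cmult)
  then have G: "geom_mean g = exp c" using gpos by (simp add: geom_mean_def)
  have "(\<lambda>n. pred_err2 n v / pred_err2 n f) \<longlonglongrightarrow> exp c"
  proof (rule pred_err2_ratio_tendsto[OF assms(1) Lv v0])
    fix \<delta> :: real assume \<delta>: "0 < \<delta>"
    obtain \<epsilon> s where s: "0 < \<epsilon>"
      "\<And>x. x \<in> Lam \<Longrightarrow> (cmod (poly s (cis x)))\<^sup>2 \<le> exp (ln (h x)) * (t x + \<epsilon>) powr (- \<alpha>)"
      "exp (c - \<delta>) \<le> (cmod (poly s 0))\<^sup>2"
      using poly_approx_regularised_weight[OF tc t0 T tpos R(3) lnh lnhc less_imp_le[OF assms(2)] \<delta>]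
      unfolding c_def by blast
    have "AE x in lebesgue_on Lam. x \<in> Lam" by (rule AE_Lam_I)
    with tpos have "AE x in lebesgue_on Lam. (cmod (poly s (cis x)))\<^sup>2 * f x \<le> v x"
    proof eventually_elim
      case (elim x)
      \<comment> \<open>Positivity of \<open>t x\<close> is essential: at a zero the right side
        would be 0 by convention.\<close>
      have "(t x + \<epsilon>) powr (- \<alpha>) \<le> t x powr (- \<alpha>)"
        using elim s(1) assms(2) by (intro powr_mono2') auto
      then have "h x * (t x + \<epsilon>) powr (- \<alpha>) \<le> g x"
        unfolding g_def using hpos[OF elim(2)] by (intro mult_left_mono) auto
      then have "(cmod (poly s (cis x)))\<^sup>2 \<le> g x"
        using s(2)[OF elim(2)] hpos[OF elim(2)] by simp
      then show ?case using f(1)[OF elim(2)] by (simp add: v_def mult.commute mult_left_mono)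
    qed
    then show "\<exists>s. (AE x in lebesgue_on Lam. (cmod (poly s (cis x)))\<^sup>2 * f x \<le> v x) \<and>
        exp (c - \<delta>) \<le> (cmod (poly s 0))\<^sup>2" using s(3) by blast
  next
    fix \<delta> :: real assume \<delta>: "0 < \<delta>"
    \<comment> \<open>The squared modulus of \<open>R ^ K\<close> on the circle is
      \<open>t powr (2 * K)\<close>; this choice makes it cancel the poles of \<open>g\<close> and
      leaves the nonnegative exponent \<open>\<beta>\<close>.\<close>
    obtain K :: nat where "\<alpha> / 2 \<le> real K" using real_arch_simple by blast
    then have K: "\<alpha> \<le> 2 * real K" by simp
    define \<beta> where "\<beta> = 2 * real K - \<alpha>"
    have \<beta>: "0 \<le> \<beta>" using K by (simp add: \<beta>_def)
    have b: "\<bar>- ln (h x)\<bar> \<le> B" if "x \<in> Lam" for x using lnh[OF that] by simp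
    have bc: "AE x in lebesgue_on Lam. isCont (\<lambda>x. - ln (h x)) x"
      using lnhc by eventually_elim (rule continuous_minus)
    obtain \<epsilon> q where q: "0 < \<epsilon>"
      "\<And>x. x \<in> Lam \<Longrightarrow> (cmod (poly q (cis x)))\<^sup>2 \<le> exp (- ln (h x)) * (t x + \<epsilon>) powr (- \<beta>)"
      "exp ((Lint (\<lambda>x. - ln (h x)) - \<beta> * Lint (\<lambda>x. ln (t x))) / (2 * pi) - \<delta>) \<le> (cmod (poly q 0))\<^sup>2"
      using poly_approx_regularised_weight[OF tc t0 T tpos R(3) b bc \<beta> \<delta>] by blast
    define r where "r = R ^ K * q"
    have cr: "(cmod (poly r z))\<^sup>2 = cmod (poly R z) ^ (2 * K) * (cmod (poly q z))\<^sup>2" for z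
      by (simp add: r_def poly_power norm_mult norm_power power_mult_distrib flip: power_mult)
        (simp add: mult.commute)
    have "AE x in lebesgue_on Lam. x \<in> Lam" by (rule AE_Lam_I)
    with tpos have "AE x in lebesgue_on Lam. (cmod (poly r (cis x)))\<^sup>2 * v x \<le> f x"
    proof eventually_elim
      case (elim x)
      note hx = hpos[OF elim(2)]
      have "cmod (poly R (cis x)) ^ (2 * K) = t x powr (2 * real K)"
        using elim(1) R(2)[of "cis x"] by (simp add: P powr_realpow flip: powr_realpow)
      then have "(cmod (poly r (cis x)))\<^sup>2 * v x =
          (cmod (poly q (cis x)))\<^sup>2 * h x * t x powr \<beta> * f x"
        unfolding cr v_def g_def \<beta>_def diff_conv_add_uminus powr_add by (simp add: algebra_simps)
      also have "\<dots> \<le> 1 * f x"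
      proof (rule mult_right_mono)
        have "t x powr \<beta> \<le> (t x + \<epsilon>) powr \<beta>"
          using elim(1) q(1) \<beta> by (intro powr_mono2) auto
        then have "(cmod (poly q (cis x)))\<^sup>2 * h x * t x powr \<beta> \<le>
            (exp (- ln (h x)) * (t x + \<epsilon>) powr (- \<beta>)) * h x * (t x + \<epsilon>) powr \<beta>"
          using q(2)[OF elim(2)] hx by (intro mult_mono) auto
        also have "\<dots> = 1"
          using hx elim(1) q(1) by (simp add: exp_minus powr_minus field_simps)
        finally show "(cmod (poly q (cis x)))\<^sup>2 * h x * t x powr \<beta> \<le> 1" .
      qed (rule f(1)[OF elim(2)])
      finally show ?case by simp
    qed
    moreover have "exp (- c - \<delta>) \<le> (cmod (poly r 0))\<^sup>2"
    proof -
      \<comment> \<open>Here the reflection of zeros pays off: without it the value at 0 could fall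
        below the geometric mean of \<open>t\<close>.\<close>
      have "Lint (\<lambda>x. ln (t x)) / (2 * pi) \<le> ln (cmod (poly R 0))"
        using R(4) by (simp add: field_simps)
      then have "exp (Lint (\<lambda>x. ln (t x)) / (2 * pi)) \<le> cmod (poly R 0)"
        using R(1) by (metis exp_le_cancel_iff exp_ln zero_less_norm_iff)
      then have "exp (Lint (\<lambda>x. ln (t x)) / (2 * pi)) ^ (2 * K) \<le> cmod (poly R 0) ^ (2 * K)"
        by (intro power_mono) auto
      then have "exp (Lint (\<lambda>x. ln (t x)) / (2 * pi)) ^ (2 * K) *
          exp ((Lint (\<lambda>x. - ln (h x)) - \<beta> * Lint (\<lambda>x. ln (t x))) / (2 * pi) - \<delta>) \<le> (cmod (poly r 0))\<^sup>2"
        unfolding cr using q(3) by (intro mult_mono) auto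
      \<comment> \<open>The integral of \<open>ln t\<close> enters with coefficient
        \<open>2 * K - \<beta> = \<alpha>\<close>, which produces exactly
        \<open>- c\<close>.\<close>
      moreover have "exp (Lint (\<lambda>x. ln (t x)) / (2 * pi)) ^ (2 * K) *
          exp ((Lint (\<lambda>x. - ln (h x)) - \<beta> * Lint (\<lambda>x. ln (t x))) / (2 * pi) - \<delta>) = exp (- c - \<delta>)"
        unfolding exp_of_nat_mult[symmetric] exp_add[symmetric]
        by (simp add: c_def \<beta>_def Lint_def field_simps)
      ultimately show ?thesis by simp
    qed
    ultimately show "\<exists>r. (AE x in lebesgue_on Lam. (cmod (poly r (cis x)))\<^sup>2 * v x \<le> f x) \<and>
        exp (- c - \<delta>) \<le> (cmod (poly r 0))\<^sup>2" by blast
  qed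
  then have "classM f g"
    using G Lv hpos by (auto simp: classM_def v_def g_def less_imp_le)
  then show ?thesis using classF_mult_classM[OF assms(1)] unfolding g_def by blast
qed

end
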